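(* Let $n\ge 3$ and $2\le k\le n$. There exists a set of Hausdorff dimension strictly greater than $n-k$ consisting of vectors $\underline{x}\in\mathbb R^n$ such that: (i) $\underline{x}$ is totally irrational; (ii* ) some tail $(\mathbf q_j)_{j\ge j_0}$ of its sequence of best approximations lies in $\bigcup_{i=1}^k\langle\mathbf e_i,\mathbf e_{n+1}\rangle_{\mathbb Z}$, these $k$ two-dimensional sublattices together spanning the $(k+1)$-dimensional sublattice $\langle\mathbf e_1,\dots,\mathbf e_k,\mathbf e_{n+1}\rangle_{\mathbb Z}$ of $\mathbb Z^{n+1}$; and (vii) no tail $(\mathbf q_j)_{j\ge j_1}$ lies in a union of fewer than $k$ two-dimensional sublattices of $\mathbb Z^{n+1}$, and no tail lies in a sublattice of $\mathbb Z^{n+1}$ of dimension at most $k$.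
   Context: Use the maximum norm; $\mathbf e_1,\dots,\mathbf e_{n+1}$ is the standard basis of $\mathbb R^{n+1}$ and $\langle\cdot\rangle_{\mathbb Z}$ denotes integer span. For $\underline{x}=(\xi_1,\dots,\xi_n)$ write $\underline{x}^*=(\xi_1,\dots,\xi_n,1)$ and for $\mathbf y\in\mathbb R^{n+1}$ let $\hat{\mathbf y}$ be its first $n$ coordinates. $\underline{x}$ is totally irrational if $\mathbf q\cdot\underline{x}^*\ne0$ for all nonzero $\mathbf q\in\mathbb Z^{n+1}$. $\mathbf q\in\mathbb Z^{n+1}$ is a best approximation for $\underline{x}$ if $|\mathbf q\cdot\underline{x}^*|=\min\{|\mathbf b\cdot\underline{x}^*|:\mathbf b\in\mathbb Z^{n+1},0<\Vert\hat{\mathbf b}\Vert\le\Vert\hat{\mathbf q}\Vert\}$; ordered by increasing norm they form the sequence $(\mathbf q_j)_{j\ge1}$. *)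

theory Defs
  imports "HOL-Analysis.Analysis"
begin

text \<open>
  Only exponents \<open>s > 0\<close> are used, so that the empty set and singletons contribute
  \<open>0 powr s = 0\<close> to a cover; this does not change the infimum defining the dimension.
  Covering sets are required to be bounded because \<^const>\<open>diameter\<close> is only meaningful then.
\<close>

definition hausdorff_premeasure :: "real \<Rightarrow> real \<Rightarrow> 'a::metric_space set \<Rightarrow> ennreal" where
  "hausdorff_premeasure s \<delta> A =
     (INF U \<in> {U :: nat \<Rightarrow> 'a set. A \<subseteq> (\<Union>i. U i) \<and> (\<forall>i. bounded (U i) \<and> diameter (U i) \<le> \<delta>)}.
        \<Sum>i. ennreal (diameter (U i) powr s))"

definition hausdorff_measure :: "real \<Rightarrow> 'a::metric_space set \<Rightarrow> ennreal" where
  "hausdorff_measure s A = (SUP \<delta>\<in>{0<..}. hausdorff_premeasure s \<delta> A)"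

definition hausdorff_dim :: "'a::metric_space set \<Rightarrow> ereal" where
  "hausdorff_dim A = (INF s\<in>{s. 0 < s \<and> hausdorff_measure s A = 0}. ereal s)"

text \<open>
  The space of dimension \<open>n + 1\<close> is represented as \<open>(real ^ 'n) \<times> real\<close> with \<open>n = CARD('n)\<close>: the
  projection \<^const>\<open>fst\<close> gives the first \<open>n\<close> coordinates, \<^const>\<open>snd\<close> the last one.
\<close>

definition int_points :: "((real ^ 'n) \<times> real) set" where
  "int_points = {q. (\<forall>i. fst q $ i \<in> \<int>) \<and> snd q \<in> \<int>}"

definition unit_vec :: "'n \<Rightarrow> (real ^ 'n) \<times> real" where
  "unit_vec i = (axis i 1, 0)"

definition last_unit_vec :: "(real ^ 'n) \<times> real" where
  "last_unit_vec = (0, 1)"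

text \<open>Real vector spaces as modules over the integers; \<open>int_module.span\<close> is the integer span.\<close>

global_interpretation int_module: module "\<lambda>(c::int) (v::'a::real_vector). of_int c *\<^sub>R v"
  by standard (simp_all add: scaleR_add_left scaleR_add_right)

text \<open>A \<open>d\<close>-dimensional sublattice: the integer span of \<open>d\<close> linearly independent integer points.\<close>

definition sublattice :: "nat \<Rightarrow> ((real ^ 'n) \<times> real) set \<Rightarrow> bool" where
  "sublattice d L \<longleftrightarrow>
     (\<exists>B. B \<subseteq> int_points \<and> finite B \<and> independent B \<and> card B = d \<and> L = int_module.span B)"

definition append_one :: "real ^ 'n \<Rightarrow> (real ^ 'n) \<times> real" where
  "append_one x = (x, 1)"

definition totally_irrational :: "real ^ 'n \<Rightarrow> bool" where
  "totally_irrational x \<longleftrightarrow> (\<forall>q\<in>int_points. q \<noteq> 0 \<longrightarrow> q \<bullet> append_one x \<noteq> 0)"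

text \<open>On \<open>real ^ 'n\<close> the maximum norm is \<^const>\<open>infnorm\<close>.\<close>

definition best_approximation :: "real ^ 'n \<Rightarrow> (real ^ 'n) \<times> real \<Rightarrow> bool" where
  "best_approximation x q \<longleftrightarrow>
     is_arg_min (\<lambda>b. \<bar>b \<bullet> append_one x\<bar>)
       (\<lambda>b. b \<in> int_points \<and> 0 < infnorm (fst b) \<and> infnorm (fst b) \<le> infnorm (fst q)) q"

text \<open>
  If \<open>q\<close> is a best approximation, then so is \<open>-q\<close>, and for totally irrational \<open>x\<close> these are the
  only ones of their norm.  The sequence picks one from each such pair.
\<close>

definition best_approximation_sequence :: "real ^ 'n \<Rightarrow> (nat \<Rightarrow> (real ^ 'n) \<times> real) \<Rightarrow> bool" where
  "best_approximation_sequence x q \<longleftrightarrow>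
     (\<forall>j. best_approximation x (q j)) \<and>
     strict_mono (\<lambda>j. infnorm (fst (q j))) \<and>
     (\<forall>b. best_approximation x b \<longrightarrow> (\<exists>j. b = q j \<or> b = - q j))"

end

theory Submission
  imports Defs "HOL-Computational_Algebra.Primes"
begin

text \<open>
  The coordinates \<open>\<xi>\<^sub>1, \<dots>, \<xi>\<^sub>k\<close> are Liouville-like numbers whose very good convergents have denominators
  \<open>M\<^sub>0 < M\<^sub>1 < \<dots>\<close>, where \<open>M\<^sub>m\<close> belongs to coordinate \<open>m mod k\<close> and \<open>M\<^sub>m\<^sub>+\<^sub>1\<close> exceeds a large power of
  \<open>M\<^sub>m\<close>. Write \<open>Q\<^sub>m\<close> for the integer point of the convergent \<open>r\<^sub>m / M\<^sub>m\<close>. If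
  \<open>b\<close> has norm less than \<open>M\<^sub>m\<^sub>+\<^sub>1\<close> and does at least as well as \<open>Q\<^sub>m\<close>, then replacing every
  \<open>\<xi>\<^sub>i\<close> by its convergent among the levels \<open>m, \<dots>, m + k - 1\<close> turns the linear form into a
  rational number too small to be nonzero. The \<open>k\<close> denominators are powers of distinct primes, so
  each divides the corresponding coefficient of \<open>b\<close>, which leaves only
  \<open>b = \<plusminus>Q\<^sub>m\<close>. Hence the best approximations are exactly the points \<open>\<plusminus>Q\<^sub>m\<close>.

  The remaining \<open>n - k\<close> coordinates only have to avoid a set of measure less than one. The
  digits of \<open>\<xi>\<^sub>1\<close> depend on a parameter \<open>t\<close> that is a Hoelder function of \<open>\<xi>\<^sub>1\<close>, because the \<open>M\<^sub>m\<close>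
  grow only polynomially from one level to the next. Pulling back Lebesgue measure along
  \<open>(t, \<xi>\<^sub>k\<^sub>+\<^sub>1, \<dots>, \<xi>\<^sub>n)\<close> gives the surplus in dimension.
\<close>

section \<open>Lower bounds for the Hausdorff dimension\<close>

text \<open>For diameters at most 1, lowering the exponent only enlarges each term of a cover sum. A
  positive lower bound for the sums with exponent \<open>s\<close> thus persists for every
  \<open>t < s\<close>, and no such \<open>t\<close> gives measure zero.\<close>

lemma hausdorff_dim_ge:
  fixes S :: "'a::metric_space set" and s c :: real
  assumes c: "c > 0"
    and cover: "\<And>U :: nat \<Rightarrow> 'a set. S \<subseteq> (\<Union>i. U i) \<Longrightarrow>
      (\<And>i. bounded (U i) \<and> diameter (U i) \<le> 1) \<Longrightarrow>
      ennreal c \<le> (\<Sum>i. ennreal (diameter (U i) powr s))"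
  shows "hausdorff_dim S \<ge> ereal s"
  unfolding hausdorff_dim_def
proof (rule INF_greatest)
  fix t :: real
  assume "t \<in> {s. 0 < s \<and> hausdorff_measure s S = 0}"
  then have null: "hausdorff_measure t S = 0" by auto
  show "ereal s \<le> ereal t"
  proof (rule ccontr)
    assume "\<not> ereal s \<le> ereal t"
    then have "t < s" by simp
    have "ennreal c \<le> hausdorff_premeasure t 1 S"
      unfolding hausdorff_premeasure_def
    proof (rule INF_greatest)
      fix U :: "nat \<Rightarrow> 'a set"
      assume "U \<in> {U. S \<subseteq> (\<Union>i. U i) \<and> (\<forall>i. bounded (U i) \<and> diameter (U i) \<le> 1)}"
      then have U: "S \<subseteq> (\<Union>i. U i)" "\<And>i. bounded (U i)" "\<And>i. diameter (U i) \<le> 1" by auto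
      have "diameter (U i) powr s \<le> diameter (U i) powr t" for i
        using U(3)[of i] diameter_ge_0[OF U(2)[of i]] \<open>t < s\<close>
        by (cases "diameter (U i) = 0") (auto intro: powr_mono')
      then have "(\<Sum>i. ennreal (diameter (U i) powr s)) \<le> (\<Sum>i. ennreal (diameter (U i) powr t))"
        by (intro suminf_le ennreal_leI) auto
      with cover[OF U(1)] U(2,3) show "ennreal c \<le> (\<Sum>i. ennreal (diameter (U i) powr t))"
        by (meson order_trans)
    qed
    also have "\<dots> \<le> hausdorff_measure t S"
      unfolding hausdorff_measure_def by (rule SUP_upper) auto
    finally show False using null c by simp
  qed
qed

text \<open>Mass distribution principle, with Lebesgue measure on \<open>T\<close> as the mass
  carried by the image. A cover of the image pulls back to a cover of \<open>T\<close>, whose total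
  measure is fixed. The set \<open>V\<close> is a measurable hull for the preimage of a covering
  set.\<close>

lemma hausdorff_dim_image_ge:
  fixes X :: "'b::euclidean_space \<Rightarrow> 'a::metric_space"
  assumes T: "T \<in> sets lborel" "emeasure lborel T > 0" "bounded T"
    and C: "C > 0"
    and preimage: "\<And>U. bounded U \<Longrightarrow> diameter U \<le> 1 \<Longrightarrow>
      \<exists>V\<in>sets lborel. T \<inter> X -` U \<subseteq> V \<and> emeasure lborel V \<le> ennreal (C * diameter U powr s)"
  shows "hausdorff_dim (X ` T) \<ge> ereal s"
proof (rule hausdorff_dim_ge)
  have fin: "emeasure lborel T < \<infinity>"
    by (rule emeasure_bounded_finite) (rule T)
  then have mT: "measure lborel T > 0" "emeasure lborel T = ennreal (measure lborel T)"
    using T(2) by (auto simp: measure_def enn2real_positive_iff)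
  then show "measure lborel T / C > 0" using C by simp
  fix U :: "nat \<Rightarrow> 'a set"
  assume U: "X ` T \<subseteq> (\<Union>i. U i)" and Ub: "\<And>i. bounded (U i) \<and> diameter (U i) \<le> 1"
  have "\<exists>V\<in>sets lborel. T \<inter> X -` U i \<subseteq> V \<and> emeasure lborel V \<le> ennreal (C * diameter (U i) powr s)" for i
    using preimage Ub by blast
  then obtain V where V: "\<And>i. V i \<in> sets lborel" "\<And>i. T \<inter> X -` U i \<subseteq> V i"
    "\<And>i. emeasure lborel (V i) \<le> ennreal (C * diameter (U i) powr s)" by metis
  have "T \<subseteq> (\<Union>i. V i)" using U V(2) by blast
  then have "emeasure lborel T \<le> emeasure lborel (\<Union>i. V i)"
    using V(1) by (intro emeasure_mono) auto
  also have "\<dots> \<le> (\<Sum>i. emeasure lborel (V i))"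
    using V(1) by (intro emeasure_subadditive_countably) auto
  also have "\<dots> \<le> (\<Sum>i. ennreal C * ennreal (diameter (U i) powr s))"
    using V(3) C by (intro suminf_le) (auto simp: ennreal_mult)
  also have "\<dots> = ennreal C * (\<Sum>i. ennreal (diameter (U i) powr s))" by simp
  finally have "ennreal (1 / C) * emeasure lborel T
      \<le> ennreal (1 / C) * (ennreal C * (\<Sum>i. ennreal (diameter (U i) powr s)))"
    by (rule mult_left_mono) simp
  also have "\<dots> = (\<Sum>i. ennreal (diameter (U i) powr s))"
    using C by (simp add: mult.assoc[symmetric] ennreal_mult[symmetric])
  finally show "ennreal (measure lborel T / C) \<le> (\<Sum>i. ennreal (diameter (U i) powr s))"
    using C mT by (simp add: ennreal_mult[symmetric])
qed

section \<open>Best approximations of interlaced Liouville vectors\<close>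

text \<open>Multiplication by all denominators yields an integer of absolute value less than 1,
  hence 0. Modulo \<open>M l\<close> only the term of index \<open>l\<close> survives, and its
  cofactors \<open>r l\<close> and \<open>P l\<close> are coprime to \<open>M l\<close>.\<close>

lemma coprime_denominators:
  fixes M :: "'i \<Rightarrow> nat" and \<beta> r :: "'i \<Rightarrow> int" and b :: int
  assumes A: "finite A" and pos: "\<And>l. l \<in> A \<Longrightarrow> M l > 0"
    and red: "\<And>l. l \<in> A \<Longrightarrow> coprime (r l) (int (M l))"
    and cop: "\<And>l l'. l \<in> A \<Longrightarrow> l' \<in> A \<Longrightarrow> l \<noteq> l' \<Longrightarrow> coprime (M l) (M l')"
    and small: "\<bar>(\<Sum>l\<in>A. of_int (\<beta> l) * of_int (r l) / real (M l)) + of_int b\<bar> * (\<Prod>l\<in>A. real (M l)) < 1"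
  shows "(\<Sum>l\<in>A. of_int (\<beta> l) * of_int (r l) / real (M l)) + of_int b = 0"
    and "l \<in> A \<Longrightarrow> int (M l) dvd \<beta> l"
proof -
  define P where "P = (\<lambda>l. \<Prod>l'\<in>A - {l}. int (M l'))"
  have P: "real_of_int (P l) * real (M l) = (\<Prod>l\<in>A. real (M l))" if "l \<in> A" for l
    using that A by (simp add: P_def prod.remove mult.commute)
  define s where "s = (\<Sum>l\<in>A. \<beta> l * r l * P l) + b * (\<Prod>l\<in>A. int (M l))"
  have pp: "(\<Prod>l\<in>A. real (M l)) > 0" using pos by (intro prod_pos) auto
  have s: "real_of_int s = ((\<Sum>l\<in>A. of_int (\<beta> l) * of_int (r l) / real (M l)) + of_int b) * (\<Prod>l\<in>A. real (M l))"
  proof -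
    have "real_of_int (\<beta> l * r l * P l) = of_int (\<beta> l) * of_int (r l) / real (M l) * (\<Prod>l\<in>A. real (M l))"
      if "l \<in> A" for l
      using P[OF that] pos[OF that] by (simp add: field_simps)
    then show ?thesis by (simp add: s_def distrib_right sum_distrib_right)
  qed
  have "\<bar>real_of_int s\<bar> < 1" unfolding s abs_mult using small pp by simp
  then have s0: "s = 0" by linarith
  then show "(\<Sum>l\<in>A. of_int (\<beta> l) * of_int (r l) / real (M l)) + of_int b = 0"
    using s pp by simp
  assume l: "l \<in> A"
  have "int (M l) dvd \<beta> l' * r l' * P l'" if "l' \<in> A - {l}" for l'
  proof -
    have "int (M l) dvd P l'" unfolding P_def using l that A by (intro dvd_prodI) auto
    then show ?thesis by simp
  qed
  then have "int (M l) dvd (\<Sum>l'\<in>A - {l}. \<beta> l' * r l' * P l')" by (rule dvd_sum)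
  moreover have "int (M l) dvd b * (\<Prod>l\<in>A. int (M l))" using l A by (intro dvd_mult dvd_prodI)
  moreover have "\<beta> l * r l * P l = - (\<Sum>l'\<in>A - {l}. \<beta> l' * r l' * P l') - b * (\<Prod>l\<in>A. int (M l))"
    using s0 sum.remove[OF A l, of "\<lambda>l. \<beta> l * r l * P l"] unfolding s_def by linarith
  ultimately have d: "int (M l) dvd \<beta> l * r l * P l" by (metis dvd_diff dvd_minus_iff)
  have "coprime (int (M l)) (P l)" unfolding P_def
    using cop l by (intro prod_coprime_right) auto
  with red[OF l] have "coprime (int (M l)) (r l * P l)" by (simp add: coprime_commute)
  with d show "int (M l) dvd \<beta> l"
    by (metis coprime_dvd_mult_left_iff mult.assoc)
qed

section \<open>Integer points, the linear form and the cyclic order of levels\<close>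

lemma int_points_infnorm:
  fixes b :: "(real ^ 'n::finite) \<times> real"
  assumes "b \<in> int_points"
  shows "\<exists>N. infnorm (fst b) = real N"
proof -
  have "infnorm (fst b) \<in> (\<lambda>i. \<bar>fst b \<bullet> i\<bar>) ` Basis"
    unfolding infnorm_Max by (rule Max_in) auto
  then obtain i where "infnorm (fst b) = \<bar>fst b $ i\<bar>"
    by (auto simp: Basis_vec_def inner_axis)
  moreover have "fst b $ i \<in> \<int>" using assms by (auto simp: int_points_def)
  then obtain c where "fst b $ i = of_int c" by (auto elim: Ints_cases)
  ultimately have "infnorm (fst b) = real (nat \<bar>c\<bar>)" by simp
  then show ?thesis by blast
qed

lemma inner_append_one:
  fixes x :: "real ^ 'n::finite"
  shows "b \<bullet> append_one x = (\<Sum>i\<in>UNIV. fst b $ i * x $ i) + snd b"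
  by (simp add: append_one_def inner_prod_def inner_vec_def)

lemma infnorm_axis: "infnorm (axis i 1 :: real ^ 'n::finite) = 1"
proof (rule antisym)
  have "norm (axis i 1 :: real ^ 'n) = 1" by simp
  then show "infnorm (axis i 1 :: real ^ 'n) \<le> 1" using infnorm_le_norm[of "axis i 1 :: real ^ 'n"] by simp
  show "1 \<le> infnorm (axis i 1 :: real ^ 'n)"
    using component_le_infnorm_cart[of "axis i 1 :: real ^ 'n" i] by simp
qed

text \<open>The hypotheses of \<open>liouville_vector\<close> speak of \<open>err\<close> and
  \<open>coord\<close>; this locale provides them while \<open>x\<close>, \<open>M\<close> and
  \<open>r\<close> are still unconstrained.\<close>

locale interlaced =
  fixes idx :: "nat \<Rightarrow> 'n::finite" and n k :: nat and x :: "real ^ 'n" and M :: "nat \<Rightarrow> nat" and r :: "nat \<Rightarrow> int"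
  assumes idx: "bij_betw idx {1..n} UNIV" and k2: "2 \<le> k" and kn: "k \<le> n"
begin

text \<open>Levels are counted from 0 and coordinates from 1, hence the successor.\<close>

definition coord :: "nat \<Rightarrow> 'n" where "coord m = idx (Suc (m mod k))"

definition Q :: "nat \<Rightarrow> (real ^ 'n) \<times> real" where
  "Q m = (real (M m) *\<^sub>R axis (coord m) 1, - of_int (r m))"

definition err :: "nat \<Rightarrow> real" where "err m = real (M m) * x $ coord m - of_int (r m)"

lemma Q_int: "Q m \<in> int_points"
  by (auto simp: Q_def int_points_def axis_def)

lemma Q_inner: "Q m \<bullet> append_one x = err m"
  by (simp add: Q_def inner_append_one err_def axis_def if_distrib if_distribR cong: if_cong)

lemma infnorm_Q: "infnorm (fst (Q m)) = real (M m)"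
  by (simp add: Q_def infnorm_mul infnorm_axis)

lemma coord_mod: "coord l = coord m \<longleftrightarrow> l mod k = m mod k"
proof -
  have "Suc (j mod k) \<in> {1..n}" for j
  proof -
    have "j mod k < k" using k2 by simp
    then show ?thesis using kn by simp
  qed
  with idx show ?thesis unfolding coord_def bij_betw_def by (metis inj_on_eq_iff nat.inject)
qed

text \<open>This makes a window of \<open>k\<close> consecutive levels provide exactly one
  convergent for each of the first \<open>k\<close> coordinates.\<close>

lemma mod_bij: "bij_betw (\<lambda>l. l mod k) {m..<m+k} {..<k}"
proof -
  have inj: "inj_on (\<lambda>l. l mod k) {m..<m+k}"
  proof (rule inj_onI)
    fix a b assume ab: "a \<in> {m..<m+k}" "b \<in> {m..<m+k}" "a mod k = b mod k"
    have *: "u = v" if "u \<le> v" "v - u < k" "u mod k = v mod k" for u v :: nat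
      using that by (metis add_diff_inverse_nat dvd_imp_mod_0 mod_eq_dvd_iff_nat
          mod_less add.right_neutral not_less)
    show "a = b"
    proof (cases "a \<le> b")
      case True with ab *[of a b] show ?thesis by auto
    next
      case False
      then have "b \<le> a" "a - b < k" using ab by auto
      then show ?thesis using *[of b a] ab(3) by simp
    qed
  qed
  have "(\<lambda>l. l mod k) ` {m..<m+k} = {..<k}"
    using k2 inj by (intro card_subset_eq) (auto simp: card_image)
  with inj show ?thesis by (simp add: bij_betw_def)
qed

lemma coord_inj: "inj_on coord {m..<m+k}"
  using mod_bij[of m] by (auto simp: inj_on_def bij_betw_def coord_mod)

lemma coord_range: "coord ` {m..<m+k} = idx ` {1..k}"
proof -
  have "coord ` {m..<m+k} = (\<lambda>c. idx (Suc c)) ` ((\<lambda>l. l mod k) ` {m..<m+k})"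
    by (auto simp: coord_def image_image)
  also have "(\<lambda>l. l mod k) ` {m..<m+k} = {..<k}" using mod_bij by (simp add: bij_betw_def)
  also have "(\<lambda>c. idx (Suc c)) ` {..<k} = idx ` (Suc ` {..<k})" by (simp add: image_image)
  also have "Suc ` {..<k} = {1..k}" by (simp add: lessThan_atLeast0 image_Suc_atLeastLessThan atLeastLessThanSuc_atLeastAtMost)
  finally show ?thesis .
qed

lemma coord_range_exists: "coord l \<in> idx ` {1..k}"
  using coord_range[of l] k2 by auto

lemma idx_cases: obtains j where "j \<in> {k<..n}" "i = idx j" | "i \<in> idx ` {1..k}"
proof -
  have "i \<in> idx ` {1..n}" using idx by (simp add: bij_betw_def)
  then obtain j where j: "j \<in> {1..n}" "i = idx j" by blast
  show thesis
  proof (cases "j \<le> k")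
    case True
    then show thesis using j that(2) by simp
  next
    case False
    then show thesis using j that(1)[of j] by simp
  qed
qed

end

text \<open>In \<open>err_small\<close> the product is the common denominator of the convergents in
  a window, and the other factor counts the form itself and \<open>k\<close> replaced coordinates
  with coefficients below \<open>M (Suc m)\<close>. The condition \<open>generic\<close> rules out
  competitors of \<open>Q m\<close> that involve one of the last \<open>n - k\<close>
  coordinates.\<close>

locale liouville_vector = interlaced idx n k x M r
  for idx :: "nat \<Rightarrow> 'n::finite" and n k :: nat and x :: "real ^ 'n" and M :: "nat \<Rightarrow> nat" and r :: "nat \<Rightarrow> int" +
  assumes M0: "M 0 = 1" and strict: "strict_mono M"
    and reduced: "\<And>m. coprime (r m) (int (M m))"
    and cop: "\<And>l m. l mod k \<noteq> m mod k \<Longrightarrow> coprime (M l) (M m)"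
    and err_nz: "\<And>m. err m \<noteq> 0"
    and err_small: "\<And>m l. m \<le> l \<Longrightarrow> l < m + k \<Longrightarrow>
      \<bar>err l\<bar> * ((1 + real k * real (M (Suc m))) * (\<Prod>j\<in>{m..<m+k}. real (M j))) < 1"
    and generic: "\<And>m b j. b \<in> int_points \<Longrightarrow> infnorm (fst b) < real (M (Suc m)) \<Longrightarrow> j \<in> {k<..n} \<Longrightarrow>
      fst b $ idx j \<noteq> 0 \<Longrightarrow> \<bar>err m\<bar> < \<bar>b \<bullet> append_one x\<bar>"
begin

lemma M_pos: "M m > 0"
  using strict_mono_less_eq[OF strict, of 0 m] M0 by simp

text \<open>By \<open>generic\<close> only the first \<open>k\<close> coefficients of
  \<open>b\<close> can be nonzero. Replacing their coordinates by convergents gives a rational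
  number that must vanish, so each denominator divides its coefficient. Size excludes all levels but
  \<open>m\<close>, and what remains is an integer multiple of \<open>Q m\<close>.\<close>

lemma minimal_is_Q:
  assumes b: "b \<in> int_points" and nz: "fst b \<noteq> 0" and less: "infnorm (fst b) < real (M (Suc m))"
    and le: "\<bar>b \<bullet> append_one x\<bar> \<le> \<bar>err m\<bar>"
  shows "b = Q m \<or> b = - Q m"
proof -
  define A where "A = {m..<m+k}"
  have mA: "m \<in> A" using k2 by (simp add: A_def)
  define \<beta> where "\<beta> = (\<lambda>l. \<lfloor>fst b $ coord l\<rfloor>)"
  define b0 where "b0 = \<lfloor>snd b\<rfloor>"
  have \<beta>: "of_int (\<beta> l) = fst b $ coord l" for l
    using b by (auto simp: \<beta>_def int_points_def)
  have b0: "of_int b0 = snd b" using b by (auto simp: b0_def int_points_def)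
  have out: "fst b $ i = 0" if "i \<notin> coord ` A" for i
    using idx_cases[of i]
  proof cases
    case (1 j)
    then show ?thesis using generic[OF b less, of j] le by fastforce
  next
    case 2
    then show ?thesis using that coord_range by (simp add: A_def)
  qed
  have "b \<bullet> append_one x = (\<Sum>i\<in>coord ` A. fst b $ i * x $ i) + snd b"
    unfolding inner_append_one using out by (simp add: sum.mono_neutral_right)
  also have "(\<Sum>i\<in>coord ` A. fst b $ i * x $ i) = (\<Sum>l\<in>A. of_int (\<beta> l) * x $ coord l)"
    using coord_inj by (simp add: sum.reindex A_def \<beta>)
  also have "\<dots> = (\<Sum>l\<in>A. of_int (\<beta> l) * of_int (r l) / real (M l)) + (\<Sum>l\<in>A. of_int (\<beta> l) * (err l / real (M l)))"
  proof -
    have "of_int (\<beta> l) * x $ coord l = of_int (\<beta> l) * of_int (r l) / real (M l) + of_int (\<beta> l) * (err l / real (M l))" for l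
      using M_pos[of l] by (simp add: err_def field_simps)
    then show ?thesis by (simp add: sum.distrib)
  qed
  finally have eq: "(\<Sum>l\<in>A. of_int (\<beta> l) * of_int (r l) / real (M l)) + of_int b0
      = b \<bullet> append_one x - (\<Sum>l\<in>A. of_int (\<beta> l) * (err l / real (M l)))" by (simp add: b0)
  have \<beta>_less: "\<bar>real_of_int (\<beta> l)\<bar> < real (M (Suc m))" for l
    using component_le_infnorm_cart[of "fst b" "coord l"] less by (simp add: \<beta>)
  define P where "P = (\<Prod>j\<in>A. real (M j))"
  \<comment> \<open>The errors to come, \<open>1 / D\<close> for the form and
    \<open>k * M (Suc m) / D\<close> for the replacements, add up to exactly
    \<open>1 / P\<close>.\<close>
  define D where "D = (1 + real k * real (M (Suc m))) * P"
  have P: "P > 0" unfolding P_def using M_pos by (intro prod_pos) auto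
  then have D: "D > 0" by (simp add: D_def add_pos_nonneg)
  have err: "\<bar>err l\<bar> < 1 / D" if "l \<in> A" for l
    using err_small[of m l] that D by (simp add: A_def D_def P_def field_simps)
  have "\<bar>\<Sum>l\<in>A. of_int (\<beta> l) * (err l / real (M l))\<bar> \<le> (\<Sum>l\<in>A. real (M (Suc m)) * (1 / D))"
  proof (rule order_trans[OF sum_abs], rule sum_mono)
    fix l assume l: "l \<in> A"
    have "\<bar>err l / real (M l)\<bar> \<le> \<bar>err l\<bar>"
      using M_pos[of l] by (simp add: divide_le_eq mult_le_cancel_left1)
    also have "\<dots> \<le> 1 / D" using err[OF l] by simp
    finally show "\<bar>of_int (\<beta> l) * (err l / real (M l))\<bar> \<le> real (M (Suc m)) * (1 / D)"
      unfolding abs_mult using \<beta>_less[of l] by (intro mult_mono) auto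
  qed
  also have "\<dots> = real k * real (M (Suc m)) / D" by (simp add: A_def)
  finally have "\<bar>(\<Sum>l\<in>A. of_int (\<beta> l) * of_int (r l) / real (M l)) + of_int b0\<bar> < 1 / D + real k * real (M (Suc m)) / D"
    using eq le err[OF mA] by linarith
  also have "\<dots> = 1 / P"
  proof -
    have "1 / D + real k * real (M (Suc m)) / D = (1 + real k * real (M (Suc m))) / D"
      by (simp add: add_divide_distrib)
    moreover have "1 + real k * real (M (Suc m)) > 0" by (simp add: add_pos_nonneg)
    ultimately show ?thesis by (simp add: D_def)
  qed
  finally have small: "\<bar>(\<Sum>l\<in>A. of_int (\<beta> l) * of_int (r l) / real (M l)) + of_int b0\<bar> * (\<Prod>l\<in>A. real (M l)) < 1"
    using P by (simp add: P_def field_simps)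
  have "coprime (M l) (M l')" if "l \<in> A" "l' \<in> A" "l \<noteq> l'" for l l'
    using that mod_bij[of m] by (intro cop) (auto simp: A_def bij_betw_def inj_on_def)
  note cd = coprime_denominators[OF _ M_pos reduced this small, simplified]
  have "finite A" by (simp add: A_def)
  note cd = cd[OF this]
  have zero: "\<beta> l = 0" if "l \<in> A" "l \<noteq> m" for l
  proof (rule ccontr)
    assume "\<beta> l \<noteq> 0"
    then have "int (M l) \<le> \<bar>\<beta> l\<bar>" using dvd_imp_le_int[OF _ cd(2)[OF that(1)]] by simp
    \<comment> \<open>Levels of the window other than \<open>m\<close> are at least
      \<open>Suc m\<close>, so a nonzero multiple of \<open>M l\<close> is too large to be a
      coefficient of \<open>b\<close>.\<close>
    moreover have "M (Suc m) \<le> M l" using that strict by (simp add: A_def strict_mono_less_eq)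
    ultimately show False using \<beta>_less[of l] by linarith
  qed
  obtain s where s: "\<beta> m = int (M m) * s" using cd(2)[OF mA] by blast
  have "(\<Sum>l\<in>A. of_int (\<beta> l) * of_int (r l) / real (M l)) = of_int (\<beta> m) * of_int (r m) / real (M m)"
    using mA zero \<open>finite A\<close> by (subst sum.remove[of _ m]) auto
  \<comment> \<open>The vanishing rational number fixes the last coordinate of
    \<open>b\<close>.\<close>
  then have "real_of_int s * of_int (r m) + of_int b0 = 0" using cd(1) s M_pos[of m] by simp
  moreover have "fst b = (of_int s * real (M m)) *\<^sub>R axis (coord m) 1"
  proof (rule vec_eq_iff[THEN iffD2], rule allI)
    fix i
    show "fst b $ i = ((of_int s * real (M m)) *\<^sub>R axis (coord m) 1) $ i"
    proof (cases "i = coord m")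
      case True
      then show ?thesis using \<beta>[of m] s by (simp add: axis_def mult.commute)
    next
      case False
      have "fst b $ i = 0"
      proof (cases "i \<in> coord ` A")
        case True
        then obtain l where "l \<in> A" "i = coord l" by auto
        then show ?thesis using False zero[of l] \<beta>[of l] by (cases "l = m") auto
      qed (rule out)
      then show ?thesis using False by (simp add: axis_def)
    qed
  qed
  ultimately have bs: "b = of_int s *\<^sub>R Q m"
    using b0 by (simp add: Q_def prod_eq_iff)
  then have "\<bar>of_int s\<bar> * \<bar>err m\<bar> \<le> \<bar>err m\<bar>" using le by (simp add: Q_inner abs_mult)
  then have "\<bar>s\<bar> \<le> 1" using err_nz[of m] by (simp add: mult_le_cancel_right1)
  moreover have "s \<noteq> 0" using bs nz by auto
  ultimately have "s = 1 \<or> s = -1" by linarith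
  then show ?thesis using bs by auto
qed

text \<open>The norm of an integer point with nonzero first part is an integer that is at least
  \<open>M 0 = 1\<close>, so it falls between two consecutive denominators.\<close>

lemma level_exists:
  assumes "b \<in> int_points" "fst b \<noteq> 0"
  obtains m where "real (M m) \<le> infnorm (fst b)" "infnorm (fst b) < real (M (Suc m))"
proof -
  obtain N where N: "infnorm (fst b) = real N" using int_points_infnorm[OF assms(1)] by blast
  have N0: "N > 0" using N assms(2) infnorm_pos_lt[of "fst b"] by simp
  define p where "p = (LEAST p. N < M p)"
  have "N < M (Suc N)" using strict_mono_imp_increasing[OF strict, of "Suc N"] by simp
  then have p: "N < M p" unfolding p_def by (rule LeastI)
  then obtain m where m: "p = Suc m" using N0 M0 by (cases p) auto
  have "\<not> N < M m" using not_less_Least[of m "\<lambda>p. N < M p"] m p_def by simp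
  then show thesis using that[of m] N p m by simp
qed

text \<open>A zero of the linear form would do at least as well as \<open>Q m\<close> at its own
  level, hence equal \<open>Q m\<close> up to sign; but \<open>err m\<close> is nonzero.\<close>

lemma totally_irrational: "totally_irrational x"
  unfolding totally_irrational_def
proof (intro ballI impI)
  fix q :: "(real ^ 'n) \<times> real"
  assume q: "q \<in> int_points" "q \<noteq> 0"
  show "q \<bullet> append_one x \<noteq> 0"
  proof (cases "fst q = 0")
    case True
    then show ?thesis using q(2) by (simp add: inner_append_one prod_eq_iff)
  next
    case False
    then obtain m where m: "infnorm (fst q) < real (M (Suc m))" using level_exists q(1) by metis
    show ?thesis
    proof
      assume 0: "q \<bullet> append_one x = 0"
      then have "q = Q m \<or> q = - Q m" using minimal_is_Q[OF q(1) False m] by simp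
      then show False using 0 err_nz[of m] by (auto simp: Q_inner)
    qed
  qed
qed

lemma Q_best: "best_approximation x (Q m)"
proof -
  have "\<not> \<bar>y \<bullet> append_one x\<bar> < \<bar>err m\<bar>"
    if "y \<in> int_points" "0 < infnorm (fst y)" "infnorm (fst y) \<le> real (M m)" for y
  proof
    assume less: "\<bar>y \<bullet> append_one x\<bar> < \<bar>err m\<bar>"
    have "M m < M (Suc m)" using strict by (simp add: strict_mono_less)
    then have "y = Q m \<or> y = - Q m"
      using that less infnorm_pos_lt[of "fst y"] by (intro minimal_is_Q) auto
    then show False using less by (auto simp: Q_inner)
  qed
  then show ?thesis
    using M_pos by (auto simp: best_approximation_def is_arg_min_def Q_int infnorm_Q Q_inner)
qed

text \<open>At the level \<open>m\<close> of \<open>b\<close> the point \<open>Q m\<close> is an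
  admissible competitor, so \<open>b\<close> does at least as well as \<open>Q m\<close> and
  \<open>minimal_is_Q\<close> applies.\<close>

lemma best_is_Q:
  assumes "best_approximation x b"
  obtains m where "b = Q m \<or> b = - Q m"
proof -
  have b: "b \<in> int_points" "fst b \<noteq> 0"
    using assms infnorm_pos_lt[of "fst b"] by (auto simp: best_approximation_def is_arg_min_def)
  obtain m where m: "real (M m) \<le> infnorm (fst b)" "infnorm (fst b) < real (M (Suc m))"
    using level_exists[OF b] .
  have "\<not> \<bar>Q m \<bullet> append_one x\<bar> < \<bar>b \<bullet> append_one x\<bar>"
  proof -
    have "\<not> \<bar>y \<bullet> append_one x\<bar> < \<bar>b \<bullet> append_one x\<bar>"
      if "y \<in> int_points" "0 < infnorm (fst y)" "infnorm (fst y) \<le> infnorm (fst b)" for y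
      using assms that unfolding best_approximation_def is_arg_min_def by blast
    then show ?thesis using Q_int[of m] m(1) M_pos[of m] by (simp add: infnorm_Q)
  qed
  then have "b = Q m \<or> b = - Q m" using b m(2) by (intro minimal_is_Q) (auto simp: Q_inner)
  then show thesis using that by blast
qed

lemma Q_sequence: "best_approximation_sequence x Q"
  unfolding best_approximation_sequence_def
proof (intro conjI allI impI)
  show "strict_mono (\<lambda>j. infnorm (fst (Q j)))" using strict by (simp add: infnorm_Q strict_mono_def)
  show "\<exists>j. b = Q j \<or> b = - Q j" if "best_approximation x b" for b
    using best_is_Q[OF that] by blast
qed (rule Q_best)

end

section \<open>Sublattices, real spans and unit vectors\<close>

lemma int_span_subset_span: "int_module.span B \<subseteq> span (B :: 'a::real_vector set)"
proof (rule int_module.span_minimal)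
  show "B \<subseteq> span B" by (rule span_superset)
  show "int_module.subspace (span B)"
    by (rule int_module.subspaceI) (auto intro: span_zero span_add span_scale)
qed

text \<open>An integer span lies in the real span of its basis, so linear independence over the
  reals bounds the rank from below.\<close>

lemma sublattice_card_le:
  assumes "sublattice d L" "independent A" "A \<subseteq> span L"
  shows "card A \<le> d"
proof -
  obtain B where B: "finite B" "card B = d" "L = int_module.span B"
    using assms(1) by (auto simp: sublattice_def)
  have "span L \<subseteq> span B"
    using int_span_subset_span[of B] by (simp add: B(3) span_minimal subspace_span)
  then have "A \<subseteq> span B" using assms(3) by blast
  then show ?thesis using independent_span_bound[OF B(1) assms(2)] B(2) by simp
qed

lemma sublattice_uminus: "sublattice d L \<Longrightarrow> v \<in> L \<Longrightarrow> - v \<in> L"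
  unfolding sublattice_def using int_module.span_neg by blast

lemma unit_vecs_independent:
  fixes J :: "'n::finite set"
  shows "independent (insert last_unit_vec (unit_vec ` J))"
    and "card (insert last_unit_vec (unit_vec ` J)) = card J + 1"
    and "insert last_unit_vec (unit_vec ` J) \<subseteq> int_points"
proof -
  have "insert last_unit_vec (unit_vec ` J) \<subseteq> (Basis :: ((real ^ 'n) \<times> real) set)"
    by (auto simp: unit_vec_def last_unit_vec_def Basis_prod_def)
  then show "independent (insert last_unit_vec (unit_vec ` J))"
    using independent_Basis independent_mono by blast
  have "last_unit_vec \<notin> unit_vec ` J" by (auto simp: unit_vec_def last_unit_vec_def)
  moreover have "inj_on unit_vec J" by (auto simp: inj_on_def unit_vec_def axis_eq_axis)
  ultimately show "card (insert last_unit_vec (unit_vec ` J)) = card J + 1"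
    by (simp add: card_image)
  show "insert last_unit_vec (unit_vec ` J) \<subseteq> int_points"
    by (auto simp: unit_vec_def last_unit_vec_def int_points_def axis_def)
qed

lemma sublattice_unit_vecs:
  fixes J :: "'n::finite set"
  shows "sublattice (card J + 1) (int_module.span (insert last_unit_vec (unit_vec ` J)))"
  unfolding sublattice_def
proof (intro exI conjI)
  show "finite (insert last_unit_vec (unit_vec ` J))" by simp
qed (rule unit_vecs_independent refl)+

lemma int_span_Union_insert:
  assumes "I \<noteq> {}"
  shows "int_module.span (\<Union>i\<in>I. int_module.span {f i, v :: 'a::real_vector}) = int_module.span (insert v (f ` I))"
proof (rule antisym; rule int_module.span_minimal)
  show "(\<Union>i\<in>I. int_module.span {f i, v}) \<subseteq> int_module.span (insert v (f ` I))"
    by (intro UN_least int_module.span_mono) auto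
  have "f i \<in> int_module.span {f i, v}" "v \<in> int_module.span {f i, v}" for i
    by (auto intro: int_module.span_base)
  then have "insert v (f ` I) \<subseteq> (\<Union>i\<in>I. int_module.span {f i, v})" using assms by fast
  then show "insert v (f ` I) \<subseteq> int_module.span (\<Union>i\<in>I. int_module.span {f i, v})"
    using int_module.span_superset by blast
qed (rule int_module.subspace_span)+

section \<open>Sublattices that contain a tail of the sequence\<close>

context liouville_vector
begin

lemma Q_in_plane: "Q m \<in> int_module.span {unit_vec (coord m), last_unit_vec}"
proof -
  have "Q m = of_int (int (M m)) *\<^sub>R unit_vec (coord m) + of_int (- r m) *\<^sub>R last_unit_vec"
    by (simp add: Q_def unit_vec_def last_unit_vec_def)
  also have "\<dots> \<in> int_module.span {unit_vec (coord m), last_unit_vec}"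
    by (intro int_module.span_add int_module.span_scale int_module.span_base) auto
  finally show ?thesis .
qed

text \<open>Two convergents of the same coordinate are reduced fractions with different
  denominators, so the determinant \<open>D\<close> of their points is nonzero and the points span
  the whole coordinate plane over the reals.\<close>

lemma plane_in_span:
  assumes "Q m \<in> span L" "Q m' \<in> span L" "coord m = coord m'" "m \<noteq> m'"
  shows "unit_vec (coord m) \<in> span L" "last_unit_vec \<in> span L"
proof -
  define D where "D = int (M m) * r m' - int (M m') * r m"
  have "D \<noteq> 0"
  proof
    assume "D = 0"
    then have eq: "int (M m) * r m' = int (M m') * r m" by (simp add: D_def)
    then have "int (M m) dvd int (M m')" "int (M m') dvd int (M m)"
      using reduced[of m] reduced[of m']
      by (metis coprime_commute coprime_dvd_mult_left_iff dvd_triv_left)+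
    then have "M m = M m'" by (simp add: dvd_antisym)
    then show False using strict \<open>m \<noteq> m'\<close> by (auto simp: strict_mono_eq)
  qed
  \<comment> \<open>This combination eliminates the component along \<open>coord m\<close>.\<close>
  have "real (M m') *\<^sub>R Q m - real (M m) *\<^sub>R Q m' = (0, of_int D)"
    using assms(3) by (simp add: Q_def D_def algebra_simps)
  then have "(0, of_int D) \<in> span L" using assms(1,2) by (metis span_diff span_scale)
  then have "(1 / of_int D) *\<^sub>R (0, of_int D) \<in> span L" by (rule span_scale)
  then show last: "last_unit_vec \<in> span L" using \<open>D \<noteq> 0\<close> by (simp add: last_unit_vec_def)
  have "unit_vec (coord m) = (1 / real (M m)) *\<^sub>R (Q m + of_int (r m) *\<^sub>R last_unit_vec)"
    using M_pos[of m] by (simp add: unit_vec_def last_unit_vec_def Q_def)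
  also have "\<dots> \<in> span L" using assms(1) last by (intro span_scale span_add)
  finally show "unit_vec (coord m) \<in> span L" .
qed

text \<open>Each \<open>Q m\<close> occurs in \<open>q\<close> up to sign. Its norm
  \<open>M m\<close> is at least \<open>m\<close>, and norms increase along \<open>q\<close>, so
  large \<open>m\<close> forces an index beyond \<open>j1\<close>.\<close>

lemma Q_in_tail:
  assumes "best_approximation_sequence x q"
  obtains m1 where "\<And>m. m \<ge> m1 \<Longrightarrow> \<exists>j\<ge>j1. Q m = q j \<or> Q m = - q j"
proof -
  obtain N where N: "infnorm (fst (q j1)) \<le> real N" using real_arch_simple by blast
  have "\<exists>j\<ge>j1. Q m = q j \<or> Q m = - q j" if "m \<ge> N" for m
  proof -
    obtain j where j: "Q m = q j \<or> Q m = - q j"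
      using assms Q_best[of m] unfolding best_approximation_sequence_def by blast
    have "infnorm (fst (q j)) = real (M m)"
      using j infnorm_Q[of m] by (auto simp: infnorm_neg)
    moreover have "m \<le> M m" using strict by (rule strict_mono_imp_increasing)
    ultimately have "infnorm (fst (q j1)) \<le> infnorm (fst (q j))" using N that by simp
    moreover have "strict_mono (\<lambda>j. infnorm (fst (q j)))"
      using assms by (simp add: best_approximation_sequence_def)
    ultimately have "j1 \<le> j" using strict_mono_less_eq by blast
    then show ?thesis using j by blast
  qed
  then show thesis using that by blast
qed

lemma sequence_in_planes:
  assumes "best_approximation_sequence x q"
  shows "q j \<in> (\<Union>i\<in>{1..k}. int_module.span {unit_vec (idx i), last_unit_vec})"
proof -
  have "best_approximation x (q j)" using assms by (simp add: best_approximation_sequence_def)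
  then obtain m where "q j = Q m \<or> q j = - Q m" by (rule best_is_Q)
  then have "q j \<in> int_module.span {unit_vec (coord m), last_unit_vec}"
    using Q_in_plane[of m] by (auto intro: int_module.span_neg)
  then show ?thesis using coord_range_exists[of m] by auto
qed

text \<open>Pigeonhole principle: infinitely many levels belong to the coordinate
  \<open>idx i\<close>, so two of their points share a member of \<open>\<L>\<close>, whose real
  span then contains the plane of that coordinate.\<close>

lemma two_in_class:
  assumes fin: "finite \<L>" and Q: "\<And>m. m \<ge> m1 \<Longrightarrow> Q m \<in> \<Union>\<L>" and i: "i \<in> {1..k}"
  obtains L where "L \<in> \<L>" "unit_vec (idx i) \<in> span L" "last_unit_vec \<in> span L"
proof -
  obtain c where c: "i = Suc c" "c < k" using i by (cases i) auto
  \<comment> \<open>These are levels of residue \<open>c\<close>, all at or beyond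
    \<open>m1\<close>.\<close>
  define f where "f = (\<lambda>u. c + k * (m1 + u))"
  have fm1: "f u \<ge> m1" for u
  proof -
    have "m1 \<le> 1 * (m1 + u)" by simp
    also have "\<dots> \<le> k * (m1 + u)" using k2 by (intro mult_right_mono) auto
    finally show ?thesis unfolding f_def by (rule trans_le_add2)
  qed
  have coord: "coord (f u) = idx i" for u
    using c by (simp add: coord_def f_def)
  have "\<exists>L\<in>\<L>. Q (f u) \<in> L" for u using Q[OF fm1[of u]] by blast
  then obtain g where g: "\<And>u. g u \<in> \<L>" "\<And>u. Q (f u) \<in> g u" by metis
  have "range g \<subseteq> \<L>" using g(1) by blast
  then have "finite (range g)" using fin by (rule finite_subset)
  then have "\<not> inj g" using range_inj_infinite[of g] by argo
  then obtain u v where uv: "u \<noteq> v" "g u = g v" unfolding inj_def by blast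
  have "f u \<noteq> f v" using uv(1) k2 unfolding f_def by simp
  have "Q (f u) \<in> span (g u)" "Q (f v) \<in> span (g u)"
    using g(2)[of u] g(2)[of v] uv(2) by (simp_all add: span_base)
  from plane_in_span[OF this _ \<open>f u \<noteq> f v\<close>] show thesis
    using that[OF g(1)[of u]] by (simp add: coord)
qed

lemma idx_inj: "inj_on idx {1..k}"
  using idx kn by (auto simp: bij_betw_def intro: inj_on_subset)

text \<open>Each of the \<open>k\<close> coordinate planes lies in the real span of a member of
  \<open>\<L>\<close>. Two planes cannot share a member, since together they contain three
  independent vectors; this gives an injection into \<open>\<L>\<close>.\<close>

lemma not_in_few_planes:
  assumes q: "best_approximation_sequence x q"
    and \<L>: "finite \<L>" "\<And>L. L \<in> \<L> \<Longrightarrow> sublattice 2 L" "\<And>j. j \<ge> j1 \<Longrightarrow> q j \<in> \<Union>\<L>"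
  shows "k \<le> card \<L>"
proof -
  obtain m1 where m1: "\<And>m. m \<ge> m1 \<Longrightarrow> \<exists>j\<ge>j1. Q m = q j \<or> Q m = - q j"
    using Q_in_tail[OF q] by blast
  have Q: "Q m \<in> \<Union>\<L>" if "m \<ge> m1" for m
  proof -
    obtain j where j: "j \<ge> j1" "Q m = q j \<or> Q m = - q j" using m1[OF \<open>m \<ge> m1\<close>] by blast
    obtain L where L: "L \<in> \<L>" "q j \<in> L" using \<L>(3)[OF j(1)] by blast
    have "Q m \<in> L" using j(2) L sublattice_uminus[OF \<L>(2)[OF L(1)]] by metis
    then show ?thesis using L(1) by blast
  qed
  have "\<exists>L. L \<in> \<L> \<and> unit_vec (idx i) \<in> span L \<and> last_unit_vec \<in> span L" if "i \<in> {1..k}" for i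
    using two_in_class[OF \<L>(1) Q that] by blast
  then obtain g where g: "\<And>i. i \<in> {1..k} \<Longrightarrow> g i \<in> \<L> \<and> unit_vec (idx i) \<in> span (g i) \<and> last_unit_vec \<in> span (g i)"
    by metis
  have "inj_on g {1..k}"
  proof (rule inj_onI, rule ccontr)
    fix i j assume ij: "i \<in> {1..k}" "j \<in> {1..k}" "g i = g j" "i \<noteq> j"
    have "card (insert last_unit_vec (unit_vec ` {idx i, idx j})) \<le> 2"
    proof (rule sublattice_card_le[OF \<L>(2)])
      show "g i \<in> \<L>" using g ij by blast
      show "independent (insert last_unit_vec (unit_vec ` {idx i, idx j}))"
        by (rule unit_vecs_independent)
      show "insert last_unit_vec (unit_vec ` {idx i, idx j}) \<subseteq> span (g i)"
        using g[OF ij(1)] g[OF ij(2)] ij(3) by auto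
    qed
    moreover have "idx i \<noteq> idx j" using inj_onD[OF idx_inj _ ij(1,2)] ij(4) by argo
    ultimately show False using unit_vecs_independent(2)[of "{idx i, idx j}"] by simp
  qed
  moreover have "g ` {1..k} \<subseteq> \<L>" using g by blast
  ultimately have "card {1..k} \<le> card \<L>" using \<L>(1) by (rule card_inj_on_le)
  then show ?thesis by simp
qed

text \<open>Applied to the family \<open>{L}\<close>, the pigeonhole argument puts all
  \<open>k\<close> planes into the real span of \<open>L\<close>, that is \<open>k + 1\<close>
  independent vectors.\<close>

lemma not_in_small_sublattice:
  assumes q: "best_approximation_sequence x q"
    and L: "sublattice d L" "\<And>j. j \<ge> j1 \<Longrightarrow> q j \<in> L"
  shows "k < d"
proof -
  obtain m1 where m1: "\<And>m. m \<ge> m1 \<Longrightarrow> \<exists>j\<ge>j1. Q m = q j \<or> Q m = - q j"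
    using Q_in_tail[OF q] by blast
  have Q: "Q m \<in> \<Union>{L}" if "m \<ge> m1" for m
  proof -
    obtain j where j: "j \<ge> j1" "Q m = q j \<or> Q m = - q j" using m1[OF \<open>m \<ge> m1\<close>] by blast
    then have "Q m \<in> L" using L(2)[OF j(1)] sublattice_uminus[OF L(1)] by metis
    then show ?thesis by blast
  qed
  have "unit_vec (idx i) \<in> span L \<and> last_unit_vec \<in> span L" if "i \<in> {1..k}" for i
    using two_in_class[of "{L}" m1 i] Q that by blast
  then have "insert last_unit_vec (unit_vec ` (idx ` {1..k})) \<subseteq> span L" using k2 by force
  from sublattice_card_le[OF L(1) unit_vecs_independent(1) this]
  show ?thesis unfolding unit_vecs_independent(2) card_image[OF idx_inj] by simp
qed

end

section \<open>Generic parameters\<close>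

definition cube :: "(real ^ 'n::finite) set" where "cube = cbox 0 (\<chi> i. 1)"

lemma mem_cube: "z \<in> cube \<longleftrightarrow> (\<forall>i. 0 \<le> z $ i \<and> z $ i \<le> 1)"
  by (simp add: cube_def mem_box_cart)

lemma emeasure_cube: "emeasure lborel (cube :: (real ^ 'n::finite) set) = 1"
proof -
  have "emeasure lborel (cube :: (real ^ 'n) set) = ennreal (measure lborel (cube :: (real ^ 'n) set))"
    unfolding cube_def by (rule emeasure_eq_ennreal_measure) (simp add: emeasure_lborel_cbox_eq)
  also have "measure lborel (cube :: (real ^ 'n) set) = 1"
    unfolding cube_def by (subst content_cbox_cart) (auto simp: interval_ne_empty_cart)
  finally show ?thesis by simp
qed

lemma cube_sets [measurable]: "cube \<in> sets borel"
  by (simp add: cube_def)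

text \<open>
  Translates of the strip along the axis \<open>j\<close> by multiples of \<open>2 * \<epsilon> / \<bar>a\<bar>\<close> are disjoint and lie in a
  box of volume 2; this replaces Fubini's theorem.
\<close>

lemma emeasure_strip_le:
  fixes \<phi> :: "real ^ 'n::finite \<Rightarrow> real"
  assumes [measurable]: "\<phi> \<in> borel_measurable borel"
    and inv: "\<And>z s. \<phi> (z + s *\<^sub>R axis j 1) = \<phi> z"
    and a: "\<bar>a\<bar> \<ge> 1" and eps: "\<epsilon> > 0"
  shows "emeasure lborel {z \<in> cube. \<bar>\<phi> z + a * z $ j\<bar> < \<epsilon>} \<le> ennreal (8 * \<epsilon>)"
proof -
  define A where "A = {z \<in> cube. \<bar>\<phi> z + a * z $ j\<bar> < \<epsilon>}"
  have A[measurable]: "A \<in> sets borel" unfolding A_def by measurable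
  have le1: "emeasure lborel A \<le> 1"
    using emeasure_mono[of A cube lborel] by (auto simp: A_def emeasure_cube)
  then have mA: "emeasure lborel A = ennreal (measure lborel A)"
    by (intro emeasure_eq_ennreal_measure) (auto simp: top_unique)
  have m1: "measure lborel A \<le> 1" using le1 unfolding mA by simp
  \<comment> \<open>So many translates fit while the total shift stays at most 1; the box is doubled
    along \<open>j\<close> for this reason.\<close>
  define R where "R = nat \<lfloor>1 / (2 * \<epsilon>)\<rfloor>"
  have R: "real R \<le> 1 / (2 * \<epsilon>)" "1 / (2 * \<epsilon>) < real R + 1"
    using eps by (auto simp: R_def)
  define c where "c = (\<lambda>i::nat. (- (2 * \<epsilon> * real i / \<bar>a\<bar>)) *\<^sub>R axis j (1::real))"
  define F where "F = (\<lambda>i. (+) (c i) -` A)"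
  have [measurable]: "F i \<in> sets borel" for i
    using measurable_sets[OF _ A, of "(+) (c i)" borel] by (simp add: F_def)
  have emF: "emeasure lborel (F i) = emeasure lborel A" for i
  proof -
    have "emeasure lborel A = emeasure (distr lborel borel ((+) (c i))) A"
      by (simp add: lborel_distr_plus)
    also have "\<dots> = emeasure lborel (F i)" by (subst emeasure_distr) (auto simp: F_def)
    finally show ?thesis by simp
  qed
  \<comment> \<open>On the translate \<open>F i\<close> the function stays within
    \<open>\<epsilon>\<close> of a value that moves by \<open>2 * \<epsilon>\<close> with each
    \<open>i\<close>, which yields disjointness.\<close>
  have val: "\<bar>\<phi> z + a * z $ j - sgn a * (2 * \<epsilon> * real i)\<bar> < \<epsilon>" if "z \<in> F i" for z i
  proof -
    have "\<bar>\<phi> (c i + z) + a * (c i + z) $ j\<bar> < \<epsilon>" using that by (auto simp: F_def A_def)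
    moreover have "\<phi> (c i + z) = \<phi> z"
      using inv[of z "- (2 * \<epsilon> * real i / \<bar>a\<bar>)"] by (simp add: c_def add.commute)
    moreover have "a * (c i + z) $ j = a * z $ j - sgn a * (2 * \<epsilon> * real i)"
      using a by (auto simp: c_def algebra_simps sgn_if abs_if field_simps)
    ultimately show ?thesis by (simp add: algebra_simps)
  qed
  have disj: "disjoint_family_on F {..<R}"
    unfolding disjoint_family_on_def
  proof (intro ballI impI, rule ccontr)
    fix i i' assume "i \<noteq> i'" "F i \<inter> F i' \<noteq> {}"
    then obtain z where z: "z \<in> F i" "z \<in> F i'" by auto
    have "\<bar>sgn a * (2 * \<epsilon> * real i) - sgn a * (2 * \<epsilon> * real i')\<bar> < 2 * \<epsilon>"
      using val[OF z(1)] val[OF z(2)] by linarith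
    moreover have "\<bar>sgn a * (2 * \<epsilon> * real i) - sgn a * (2 * \<epsilon> * real i')\<bar> = 2 * \<epsilon> * \<bar>real i - real i'\<bar>"
    proof -
      have "sgn a * (2 * \<epsilon> * real i) - sgn a * (2 * \<epsilon> * real i') = sgn a * (2 * \<epsilon>) * (real i - real i')"
        by (simp add: algebra_simps)
      moreover have "\<bar>sgn a\<bar> = 1" using a by (auto simp: abs_sgn_eq)
      ultimately show ?thesis using eps by (simp add: abs_mult)
    qed
    moreover have "\<bar>real i - real i'\<bar> \<ge> 1" using \<open>i \<noteq> i'\<close> by linarith
    ultimately show False using eps by simp
  qed
  define B where "B = cbox (0 :: real ^ 'n) (\<chi> i. if i = j then 2 else 1)"
  have "F i \<subseteq> B" if "i < R" for i
  proof
    fix z assume "z \<in> F i"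
    then have z: "c i + z \<in> cube" by (simp add: F_def A_def)
    define d where "d = 2 * \<epsilon> * real i / \<bar>a\<bar>"
    have ci: "c i = (- d) *\<^sub>R axis j 1" by (simp add: c_def d_def)
    have s: "0 \<le> d" using eps by (simp add: d_def)
    have "2 * \<epsilon> * real i / \<bar>a\<bar> \<le> 2 * \<epsilon> * real R / 1"
      using that a eps by (intro frac_le mult_left_mono) auto
    also have "\<dots> \<le> 1" using R(1) eps by (simp add: field_simps)
    finally have s1: "d \<le> 1" by (simp add: d_def)
    show "z \<in> B"
      unfolding B_def mem_box_cart
    proof (intro allI)
      fix i'
      show "0 $ i' \<le> z $ i' \<and> z $ i' \<le> (\<chi> i. if i = j then 2 else 1) $ i'"
        using z[unfolded mem_cube, rule_format, of i'] s s1
        by (auto simp: ci axis_def split: if_splits)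
    qed
  qed
  then have sub: "(\<Union>i<R. F i) \<subseteq> B" by auto
  have "emeasure lborel B = ennreal (measure lborel B)"
    unfolding B_def by (rule emeasure_eq_ennreal_measure) (simp add: emeasure_lborel_cbox_eq)
  also have "measure lborel B = 2"
    unfolding B_def by (subst content_cbox_cart) (auto simp: interval_ne_empty_cart)
  finally have emB: "emeasure lborel B = 2" by simp
  have "of_nat R * emeasure lborel A = (\<Sum>i<R. emeasure lborel (F i))" by (simp add: emF)
  also have "\<dots> = emeasure lborel (\<Union>i<R. F i)"
    using disj by (intro sum_emeasure) auto
  also have "\<dots> \<le> 2" unfolding emB[symmetric] using sub by (intro emeasure_mono) (auto simp: B_def)
  finally have "ennreal (real R * measure lborel A) \<le> ennreal 2"
    by (simp add: mA ennreal_mult ennreal_of_nat_eq_real_of_nat)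
  then have Rm: "real R * measure lborel A \<le> 2" by (subst (asm) ennreal_le_iff) auto
  have "measure lborel A \<le> 8 * \<epsilon>"
  \<comment> \<open>For small \<open>\<epsilon>\<close> rounding down loses at most half of
    \<open>1 / (2 * \<epsilon>)\<close>; for large \<open>\<epsilon>\<close> the trivial bound 1
    suffices.\<close>
  proof (cases "\<epsilon> \<le> 1 / 4")
    case True
    then have "1 / (4 * \<epsilon>) \<ge> 1" using eps by (simp add: field_simps)
    moreover have "1 / (2 * \<epsilon>) = 1 / (4 * \<epsilon>) + 1 / (4 * \<epsilon>)" by simp
    ultimately have "real R \<ge> 1 / (4 * \<epsilon>)" using R(2) by linarith
    then have "1 / (4 * \<epsilon>) * measure lborel A \<le> real R * measure lborel A"
      by (rule mult_right_mono) simp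
    then have "1 / (4 * \<epsilon>) * measure lborel A \<le> 2" using Rm by linarith
    then show ?thesis using eps by (simp add: field_simps)
  next
    case False
    then show ?thesis using m1 by simp
  qed
  then show ?thesis unfolding A_def[symmetric] mA by (rule ennreal_leI)
qed

lemma card_int_points_le:
  fixes N G :: nat
  defines "S \<equiv> {b :: (real ^ 'n::finite) \<times> real. b \<in> int_points \<and> infnorm (fst b) \<le> real N \<and> \<bar>snd b\<bar> \<le> real G}"
  shows "finite S" "card S \<le> (2 * N + 1) ^ CARD('n) * (2 * G + 1)"
proof -
  define D where "D = (Pi\<^sub>E (UNIV :: 'n set) (\<lambda>_. {- int N..int N})) \<times> {- int G..int G}"
  define f :: "('n \<Rightarrow> int) \<times> int \<Rightarrow> (real ^ 'n) \<times> real"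
    where "f = (\<lambda>p. (\<chi> i. of_int (fst p i), of_int (snd p)))"
  have fin: "finite D" by (simp add: D_def finite_PiE)
  have sub: "S \<subseteq> f ` D"
  proof
    fix b assume "b \<in> S"
    then have b: "b \<in> int_points" "infnorm (fst b) \<le> real N" "\<bar>snd b\<bar> \<le> real G" by (auto simp: S_def)
    define p where "p = (\<lambda>i. \<lfloor>fst b $ i\<rfloor>, \<lfloor>snd b\<rfloor>)"
    have i: "real_of_int (fst p i) = fst b $ i" "real_of_int (snd p) = snd b" for i
      using b(1) by (auto simp: p_def int_points_def)
    have "\<bar>fst b $ i\<bar> \<le> real N" for i
      using component_le_infnorm_cart[of "fst b" i] b(2) by linarith
    then have "\<bar>fst p i\<bar> \<le> int N" for i using i(1)[of i] by (metis of_int_abs of_int_le_iff of_int_of_nat_eq)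
    moreover have "\<bar>snd p\<bar> \<le> int G" using b(3) i(2) by (metis of_int_abs of_int_le_iff of_int_of_nat_eq)
    ultimately have "p \<in> D" by (auto simp: D_def mem_Times_iff PiE_iff abs_le_iff minus_le_iff)
    moreover have "f p = b" using i by (simp add: f_def prod_eq_iff vec_eq_iff)
    ultimately show "b \<in> f ` D" by blast
  qed
  then show "finite S" using fin finite_surj by blast
  have "card S \<le> card D" using sub fin by (meson card_image_le card_mono finite_imageI le_trans)
  also have "card D = (2 * N + 1) ^ CARD('n) * (2 * G + 1)"
  proof -
    have "nat (1 + int N + int N) = 2 * N + 1" "nat (1 + int G + int G) = 2 * G + 1" by auto
    then show ?thesis by (simp add: D_def card_cartesian_product card_PiE algebra_simps)
  qed
  finally show "card S \<le> (2 * N + 1) ^ CARD('n) * (2 * G + 1)" .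
qed

text \<open>A union bound over integer points: those of norm at most \<open>N\<close> whose last
  coordinate is not too large number \<open>O(N ^ (n + 1))\<close>, and each excludes a strip of
  measure \<open>O(\<kappa> / N ^ (n + 3))\<close>. The constant \<open>\<kappa>\<close> is fixed
  before \<open>X\<close>, because the construction of \<open>X\<close> will depend on it.\<close>

lemma generic_parameters:
  fixes Y :: real
  assumes Y: "Y \<ge> 1"
  obtains \<kappa> :: real where "0 < \<kappa>" "\<And>X :: real ^ 'n::finite \<Rightarrow> real ^ 'n. \<And>J.
    (\<And>i. (\<lambda>z. X z $ i) \<in> borel_measurable borel) \<Longrightarrow>
    (\<And>z i. z \<in> cube \<Longrightarrow> \<bar>X z $ i\<bar> \<le> Y) \<Longrightarrow>
    (\<And>z j. j \<in> J \<Longrightarrow> X z $ j = z $ j) \<Longrightarrow>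
    (\<And>z s i j. j \<in> J \<Longrightarrow> i \<noteq> j \<Longrightarrow> X (z + s *\<^sub>R axis j 1) $ i = X z $ i) \<Longrightarrow>
    \<exists>T. T \<in> sets lborel \<and> T \<subseteq> cube \<and> emeasure lborel T > 0 \<and>
      (\<forall>z\<in>T. \<forall>b\<in>int_points. (\<exists>j\<in>J. fst b $ j \<noteq> 0) \<longrightarrow>
         \<kappa> / infnorm (fst b) ^ (CARD('n) + 3) \<le> \<bar>b \<bullet> append_one (X z)\<bar>)"
proof -
  define n where "n = CARD('n)"
  \<comment> \<open>If the last coordinate of \<open>b\<close> exceeds \<open>G * N\<close>, it
    outweighs the other terms and the form is at least \<open>N\<close>.\<close>
  obtain G :: nat where G: "real n * Y + 1 \<le> real G" using real_arch_simple by blast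
  then have G1: "real G \<ge> 1" using Y by (smt (verit) of_nat_0_le_iff mult_nonneg_nonneg)
  \<comment> \<open>The factor 8 comes from the strip estimate, the rest from the number of points.
    The choice of \<open>\<kappa>\<close> makes the total measure at most
    \<open>pi\<^sup>2 / 36\<close>.\<close>
  define K where "K = 8 * 3 ^ (n + 1) * real G"
  have K: "K \<ge> 1" unfolding K_def using G1 one_le_power[of "3::real" "n + 1"] by (simp add: mult_ge1_I)
  define \<kappa> where "\<kappa> = 1 / (6 * K)"
  have \<kappa>: "\<kappa> > 0" "\<kappa> \<le> 1" "K * \<kappa> = 1 / 6" using K by (auto simp: \<kappa>_def field_simps)
  define S where "S = (\<lambda>N. {b :: (real ^ 'n) \<times> real. b \<in> int_points \<and> infnorm (fst b) \<le> real N \<and> \<bar>snd b\<bar> \<le> real (G * N)})"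
  have S: "finite (S N)" "card (S N) \<le> (2 * N + 1) ^ n * (2 * (G * N) + 1)" for N
    unfolding S_def n_def by (rule card_int_points_le)+
  show thesis
  proof (rule that[OF \<kappa>(1)])
    fix X :: "real ^ 'n \<Rightarrow> real ^ 'n" and J :: "'n set"
    assume meas[measurable]: "\<And>i. (\<lambda>z. X z $ i) \<in> borel_measurable borel"
      and bound: "\<And>z i. z \<in> cube \<Longrightarrow> \<bar>X z $ i\<bar> \<le> Y"
      and free: "\<And>z j. j \<in> J \<Longrightarrow> X z $ j = z $ j"
      and inv: "\<And>z s i j. j \<in> J \<Longrightarrow> i \<noteq> j \<Longrightarrow> X (z + s *\<^sub>R axis j 1) $ i = X z $ i"
    define E where "E = (\<lambda>N. \<kappa> / real N ^ (n + 3))"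
    define bad where "bad = (\<lambda>N b. {z \<in> cube. \<bar>b \<bullet> append_one (X z)\<bar> < E N})"
    have [measurable]: "bad N b \<in> sets borel" for N b
      unfolding bad_def inner_append_one by measurable
    have bad_le: "emeasure lborel (bad N b) \<le> ennreal (8 * E N)"
      if N: "N > 0" and b: "b \<in> int_points" and j: "j \<in> J" "fst b $ j \<noteq> 0" for N b j
    proof -
      \<comment> \<open>Splitting off the coordinate \<open>j\<close> leaves a function invariant
        along that axis, and the integer coefficient of \<open>z $ j\<close> has absolute value at
        least 1.\<close>
      define \<phi> where "\<phi> = (\<lambda>z. (\<Sum>i\<in>UNIV - {j}. fst b $ i * X z $ i) + snd b)"
      have "b \<bullet> append_one (X z) = \<phi> z + fst b $ j * z $ j" for z
        using j by (simp add: inner_append_one \<phi>_def sum.remove[of UNIV j] free)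
      then have eq: "bad N b = {z \<in> cube. \<bar>\<phi> z + fst b $ j * z $ j\<bar> < E N}" by (simp add: bad_def)
      have "fst b $ j \<in> \<int>" using b by (simp add: int_points_def)
      then have "\<bar>fst b $ j\<bar> \<ge> 1" using j(2) by (rule Ints_nonzero_abs_ge1)
      moreover have "\<phi> \<in> borel_measurable borel" unfolding \<phi>_def by measurable
      moreover have "\<phi> (z + s *\<^sub>R axis j 1) = \<phi> z" for z s
        unfolding \<phi>_def using inv[OF j(1)] by (intro arg_cong2[where f = "(+)"] sum.cong) auto
      moreover have "E N > 0" using N \<kappa> by (simp add: E_def)
      ultimately show ?thesis unfolding eq by (intro emeasure_strip_le)
    qed
    define SJ where "SJ = (\<lambda>N. {b \<in> S N. \<exists>j\<in>J. fst b $ j \<noteq> 0})"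
    have SJ: "finite (SJ N)" "card (SJ N) \<le> card (S N)" for N
      using S(1)[of N] by (auto simp: SJ_def intro: card_mono)
    define Bad where "Bad = (\<lambda>h. \<Union>b\<in>SJ (Suc h). bad (Suc h) b)"
    have [measurable]: "Bad h \<in> sets borel" for h
      unfolding Bad_def using SJ(1) by (intro sets.finite_UN) auto
    have Bad: "emeasure lborel (Bad h) \<le> ennreal (1 / 6 * (1 / (real h + 1)\<^sup>2))" for h
    proof -
      define N where "N = Suc h"
      have N: "N > 0" by (simp add: N_def)
      have "emeasure lborel (Bad h) \<le> (\<Sum>b\<in>SJ N. emeasure lborel (bad N b))"
        unfolding Bad_def N_def[symmetric] using SJ(1) by (intro emeasure_subadditive_finite) auto
      also have "\<dots> \<le> (\<Sum>b\<in>SJ N. ennreal (8 * E N))"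
        using bad_le[OF N] by (intro sum_mono) (auto simp: SJ_def S_def)
      also have "\<dots> = ennreal (real (card (SJ N)) * (8 * E N))"
        by (simp add: ennreal_mult' ennreal_of_nat_eq_real_of_nat)
      also have "real (card (SJ N)) * (8 * E N) \<le> real (3 ^ (n + 1) * G * N ^ (n + 1)) * (8 * E N)"
      proof (intro mult_right_mono of_nat_mono)
        have "card (SJ N) \<le> (2 * N + 1) ^ n * (2 * (G * N) + 1)"
          using SJ(2)[of N] S(2)[of N] by linarith
        also have "\<dots> \<le> (3 * N) ^ n * (3 * (G * N))"
          using N G1 by (intro mult_mono power_mono) auto
        finally show "card (SJ N) \<le> 3 ^ (n + 1) * G * N ^ (n + 1)"
          by (simp add: power_mult_distrib algebra_simps)
        show "0 \<le> 8 * E N" using \<kappa> by (simp add: E_def)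
      qed
      also have "real (3 ^ (n + 1) * G * N ^ (n + 1)) * (8 * E N) = K * \<kappa> * (real N ^ (n + 1) / real N ^ (n + 3))"
        by (simp add: K_def E_def)
      also have "real N ^ (n + 1) / real N ^ (n + 3) = 1 / (real h + 1)\<^sup>2"
      proof -
        have "real N ^ (n + 3) = real N ^ (n + 1) * (real N)\<^sup>2"
          using power_add[of "real N" "n + 1" 2] by (simp add: numeral_eq_Suc)
        moreover have "real N ^ (n + 1) \<noteq> 0" "real N = real h + 1" using N by (auto simp: N_def)
        ultimately show ?thesis by simp
      qed
      finally show ?thesis by (simp add: \<kappa>(3) ennreal_leI)
    qed
    have sums: "(\<lambda>h. 1 / 6 * (1 / (real h + 1)\<^sup>2)) sums (1 / 6 * (pi\<^sup>2 / 6))"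
      using inverse_squares_sums by (intro sums_mult) (simp add: add.commute)
    have "emeasure lborel (\<Union>h. Bad h) \<le> (\<Sum>h. emeasure lborel (Bad h))"
      by (intro emeasure_subadditive_countably) auto
    also have "\<dots> \<le> (\<Sum>h. ennreal (1 / 6 * (1 / (real h + 1)\<^sup>2)))"
      using Bad by (intro suminf_le) auto
    also have "\<dots> = ennreal (1 / 6 * (pi\<^sup>2 / 6))"
      using sums by (intro suminf_ennreal_eq) auto
    also have "\<dots> < ennreal 1"
    proof (rule ennreal_lessI)
      have "pi\<^sup>2 < 4\<^sup>2" using pi_less_4 pi_ge_zero by (intro power_strict_mono) auto
      then show "1 / 6 * (pi\<^sup>2 / 6) < 1" by simp
    qed simp
    finally have less1: "emeasure lborel (\<Union>h. Bad h) < 1" by simp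
    define T where "T = cube - (\<Union>h. Bad h)"
    have T: "T \<in> sets lborel" "T \<subseteq> cube" by (auto simp: T_def)
    have "emeasure lborel T > 0"
    proof (rule ccontr)
      assume "\<not> emeasure lborel T > 0"
      then have T0: "emeasure lborel T = 0" by simp
      have "1 = emeasure lborel (cube :: (real ^ 'n) set)" by (simp add: emeasure_cube)
      also have "\<dots> \<le> emeasure lborel (T \<union> (\<Union>h. Bad h))" by (rule emeasure_mono) (auto simp: T_def)
      also have "\<dots> \<le> emeasure lborel T + emeasure lborel (\<Union>h. Bad h)"
        using T by (intro emeasure_subadditive) auto
      finally show False using less1 T0 by simp
    qed
    moreover have "\<kappa> / infnorm (fst b) ^ (CARD('n) + 3) \<le> \<bar>b \<bullet> append_one (X z)\<bar>"
      if z: "z \<in> T" and b: "b \<in> int_points" and j: "j \<in> J" "fst b $ j \<noteq> 0" for z b j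
    proof -
      obtain N where N: "infnorm (fst b) = real N" using int_points_infnorm[OF b] by blast
      have "fst b \<noteq> 0" using j by auto
      then have N0: "N > 0" using N infnorm_pos_lt[of "fst b"] by simp
      then obtain h where h: "N = Suc h" by (cases N) auto
      show ?thesis
      proof (cases "\<bar>snd b\<bar> \<le> real (G * N)")
        case True
        then have "b \<in> SJ N" using b j N by (auto simp: SJ_def S_def)
        then have "z \<notin> bad N b" using z by (auto simp: T_def Bad_def h)
        then have "E N \<le> \<bar>b \<bullet> append_one (X z)\<bar>" using z by (auto simp: bad_def T_def)
        then show ?thesis by (simp add: E_def N n_def)
      next
        case False
        have "\<bar>\<Sum>i\<in>UNIV. fst b $ i * X z $ i\<bar> \<le> (\<Sum>i\<in>(UNIV :: 'n set). real N * Y)"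
        proof (rule order_trans[OF sum_abs], rule sum_mono)
          fix i
          show "\<bar>fst b $ i * X z $ i\<bar> \<le> real N * Y"
            unfolding abs_mult using component_le_infnorm_cart[of "fst b" i] N bound[of z i] z
            by (intro mult_mono) (auto simp: T_def)
        qed
        also have "\<dots> = real N * (real n * Y)" by (simp add: n_def)
        finally have "\<bar>snd b\<bar> - real N * (real n * Y) \<le> \<bar>b \<bullet> append_one (X z)\<bar>"
          unfolding inner_append_one by linarith
        moreover have "real N * (real n * Y + 1) \<le> real N * real G" using G by (intro mult_left_mono) auto
        ultimately have "real N \<le> \<bar>b \<bullet> append_one (X z)\<bar>" using False by (simp add: algebra_simps)
        moreover have "\<kappa> / real N ^ (CARD('n) + 3) \<le> 1"
        proof -
          have "1 \<le> real N ^ (CARD('n) + 3)" using N0 by (intro one_le_power) simp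
          then have "\<kappa> \<le> real N ^ (CARD('n) + 3)" using \<kappa>(2) by linarith
          then show ?thesis using N0 by simp
        qed
        moreover have "real N \<ge> 1" using N0 by simp
        ultimately show ?thesis unfolding N by (meson order_trans)
      qed
    qed
    ultimately show "\<exists>T. T \<in> sets lborel \<and> T \<subseteq> cube \<and> emeasure lborel T > 0 \<and>
      (\<forall>z\<in>T. \<forall>b\<in>int_points. (\<exists>j\<in>J. fst b $ j \<noteq> 0) \<longrightarrow>
         \<kappa> / infnorm (fst b) ^ (CARD('n) + 3) \<le> \<bar>b \<bullet> append_one (X z)\<bar>)"
      using T by blast
  qed
qed

section \<open>Numbers with prescribed prime power denominators\<close>

text \<open>The added 1 lets the exponents leave 0 and supplies one extra factor
  \<open>2 ^ E\<close> per level, which absorbs the constants in \<open>N_Suc\<close>.\<close>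

primrec tower_exp :: "nat \<Rightarrow> nat \<Rightarrow> nat" where
  "tower_exp E 0 = 0"
| "tower_exp E (Suc m) = E * (tower_exp E m + 1)"

text \<open>Residue class \<open>c\<close> of levels uses powers of the prime \<open>B c\<close>.
  Later \<open>Z\<close> beats constant factors and \<open>W\<close> beats powers;
  \<open>growth\<close> makes each level exceed the power \<open>W\<close> of \<open>Z\<close> times
  the previous one.\<close>

locale prime_digits =
  fixes B :: "nat \<Rightarrow> nat" and Bmax k E Z W :: nat
  assumes B_prime: "\<And>c. prime (B c)" and B_inj: "inj B" and B_max: "\<And>c. c < k \<Longrightarrow> B c \<le> Bmax"
    and k_pos: "0 < k" and Z2: "2 \<le> Z" and W1: "1 \<le> W"
    and growth: "(Z * Bmax) ^ W \<le> 2 ^ E"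
begin

abbreviation e :: "nat \<Rightarrow> nat" where "e \<equiv> tower_exp E"

definition N :: "nat \<Rightarrow> nat" where "N m = B (m mod k) ^ e m"

text \<open>The denominator is a square so that a digit of size about \<open>N m\<close> still
  contributes a term of size only about \<open>1 / N m\<close>.\<close>

definition M :: "nat \<Rightarrow> nat" where "M m = (N m)\<^sup>2"

lemma B_ge: "2 \<le> B c" using B_prime prime_ge_2_nat by blast

lemma B_mod_le: "B (m mod k) \<le> Bmax" using B_max k_pos by simp

lemma Bmax_ge: "2 \<le> Bmax" using B_ge[of 0] B_max[OF k_pos] by linarith

lemma E_pos: "1 \<le> E"
proof (rule ccontr)
  assume "\<not> 1 \<le> E"
  then have "(Z * Bmax) ^ W \<le> 1" using growth by (simp add: not_less_eq_eq)
  moreover have "2 * 2 \<le> Z * Bmax" using Z2 Bmax_ge by (rule mult_le_mono)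
  then have "(Z * Bmax) ^ 1 \<le> (Z * Bmax) ^ W" using W1 by (intro power_increasing) linarith+
  ultimately show False using \<open>2 * 2 \<le> Z * Bmax\<close> by simp
qed

lemma e_strict: "strict_mono e"
  unfolding strict_mono_Suc_iff
proof
  fix j
  have "1 * (e j + 1) \<le> E * (e j + 1)" using E_pos by (rule mult_le_mono1)
  then show "e j < e (Suc j)" by simp
qed

lemma N_0: "N 0 = 1" by (simp add: N_def)

lemma N_pos: "0 < N m" using B_ge[of "m mod k"] by (simp add: N_def)

text \<open>Consecutive levels have different bases; all of them lie between 2 and
  \<open>Bmax\<close>, so \<open>N m\<close> is bounded by a power of \<open>Bmax\<close> and
  \<open>N (Suc m)\<close> from below by a power of 2.\<close>

lemma N_Suc: "(Z * N m) ^ W \<le> N (Suc m)"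
proof -
  have "Z * N m \<le> Z ^ (e m + 1) * Bmax ^ (e m + 1)"
  proof (rule mult_le_mono)
    show "Z \<le> Z ^ (e m + 1)" using Z2 by simp
    have "N m \<le> Bmax ^ e m" unfolding N_def using B_mod_le by (rule power_mono) simp
    also have "\<dots> \<le> Bmax ^ (e m + 1)" using Bmax_ge by (intro power_increasing) auto
    finally show "N m \<le> Bmax ^ (e m + 1)" .
  qed
  then have "Z * N m \<le> (Z * Bmax) ^ (e m + 1)" by (simp only: power_mult_distrib)
  then have "(Z * N m) ^ W \<le> ((Z * Bmax) ^ (e m + 1)) ^ W" by (rule power_mono) simp
  also have "\<dots> = ((Z * Bmax) ^ W) ^ (e m + 1)"
    by (simp only: power_mult[symmetric] mult.commute[of "e m + 1"])
  also have "\<dots> \<le> (2 ^ E) ^ (e m + 1)" using growth by (rule power_mono) simp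
  also have "\<dots> = 2 ^ (E * (e m + 1))" by (rule power_mult[symmetric])
  also have "\<dots> = 2 ^ e (Suc m)" by simp
  also have "\<dots> \<le> N (Suc m)" unfolding N_def using B_ge by (rule power_mono) simp
  finally show ?thesis .
qed

lemma N_double: "2 * N m \<le> N (Suc m)"
proof -
  have "2 * N m \<le> (Z * N m) ^ 1" using Z2 by simp
  also have "\<dots> \<le> (Z * N m) ^ W" using W1 Z2 N_pos[of m] by (intro power_increasing) (auto simp: Suc_le_eq)
  finally show ?thesis using N_Suc[of m] by linarith
qed

lemma N_strict: "strict_mono N"
  unfolding strict_mono_Suc_iff using N_double N_pos by (metis Suc_le_eq less_le_trans mult_2 less_add_same_cancel1)

lemma N_mono: "i \<le> j \<Longrightarrow> N i \<le> N j"
  using N_strict by (simp add: strict_mono_less_eq)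

lemma N_power: "2 ^ j * N m \<le> N (m + j)"
proof (induction j)
  case (Suc j)
  have "2 ^ Suc j * N m \<le> 2 * N (m + j)" using Suc by simp
  also have "\<dots> \<le> N (m + Suc j)" using N_double[of "m + j"] by simp
  finally show ?case .
qed simp

text \<open>Growth is also bounded above: \<open>e + 1\<close> gains at most a factor
  \<open>2 * E\<close> per level, so passing to the next level of the same residue class costs only
  a fixed power. The Hoelder exponent rests on this.\<close>

lemma N_step_le: "N (m + k) \<le> (2 * N m) ^ (Bmax * (2 * E) ^ k)"
proof -
  have e: "e (m + j) + 1 \<le> (2 * E) ^ j * (e m + 1)" for j
  proof (induction j)
    case (Suc j)
    have "e (m + Suc j) + 1 \<le> 2 * E * (e (m + j) + 1)" using E_pos by simp
    also have "\<dots> \<le> 2 * E * ((2 * E) ^ j * (e m + 1))" using Suc by (rule mult_le_mono2)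
    finally show ?case by (simp only: power_Suc mult.assoc)
  qed simp
  have "N (m + k) \<le> Bmax ^ e (m + k)" unfolding N_def using B_mod_le by (rule power_mono) simp
  also have "\<dots> \<le> Bmax ^ ((2 * E) ^ k * (e m + 1))" using e[of k] Bmax_ge by (intro power_increasing) auto
  \<comment> \<open>The base becomes a power of 2, since \<open>2 ^ e m\<close> is the available
    lower bound for \<open>N m\<close>.\<close>
  also have "\<dots> \<le> (2 ^ Bmax) ^ ((2 * E) ^ k * (e m + 1))"
    using less_exp[of Bmax] by (intro power_mono) auto
  also have "\<dots> = (2 * 2 ^ e m) ^ (Bmax * (2 * E) ^ k)"
    by (simp add: power_mult[symmetric] power_Suc[symmetric] ac_simps del: power_Suc)
  also have "\<dots> \<le> (2 * N m) ^ (Bmax * (2 * E) ^ k)"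
    unfolding N_def using B_ge by (intro power_mono mult_le_mono2) auto
  finally show ?thesis .
qed

lemma M_strict: "strict_mono M"
proof (rule strict_monoI)
  fix i j :: nat
  assume "i < j"
  then have "N i < N j" using N_strict by (simp add: strict_mono_less)
  then show "M i < M j" unfolding M_def by (rule power_strict_mono) auto
qed

lemma M_coprime: "l mod k \<noteq> m mod k \<Longrightarrow> coprime (M l) (M m)"
  using B_inj primes_coprime[OF B_prime B_prime, of "l mod k" "m mod k"]
  by (simp add: M_def N_def inj_eq)

text \<open>
  The digit at level \<open>l\<close> contains the whole initial expansion of \<open>t\<close> of size \<open>N l\<close>, not only a new
  block of it. This makes every term of the series monotone in \<open>t\<close>.
\<close>

definition digit :: "real \<Rightarrow> nat \<Rightarrow> int" where
  "digit t l = 1 + int (B (l mod k)) * \<lfloor>real (N l) * t\<rfloor>"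

definition \<tau> :: "real \<Rightarrow> nat \<Rightarrow> real" where
  "\<tau> t l = of_int (digit t l) / real (M l)"

text \<open>For \<open>l < k\<close> this is a full coordinate of the vector; for
  \<open>l = m + k\<close> it is the remainder of that series after level \<open>m\<close>.\<close>

definition tail :: "real \<Rightarrow> nat \<Rightarrow> real" where
  "tail t l = (\<Sum>u. \<tau> t (l + k * u))"

text \<open>The numerator over \<open>M m\<close> of the partial sum up to level \<open>m\<close>;
  the power of the prime is the quotient of \<open>M m\<close> by the denominator of the respective
  term.\<close>

definition num :: "real \<Rightarrow> nat \<Rightarrow> int" where
  "num t m = (\<Sum>u\<le>m div k. digit t (m mod k + k * u) * int (B (m mod k) ^ (2 * (e m - e (m mod k + k * u)))))"

lemma tau_bounds:
  assumes t: "0 \<le> t" "t \<le> 1"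
  shows "0 < \<tau> t l" "\<tau> t l \<le> 2 * real Bmax / real (N l)"
proof -
  have fl: "0 \<le> \<lfloor>real (N l) * t\<rfloor>" "\<lfloor>real (N l) * t\<rfloor> \<le> int (N l)"
  proof -
    show "0 \<le> \<lfloor>real (N l) * t\<rfloor>" using t by simp
    have "real (N l) * t \<le> real (N l) * 1" using t by (intro mult_left_mono) auto
    then show "\<lfloor>real (N l) * t\<rfloor> \<le> int (N l)" by (simp add: floor_le_iff)
  qed
  then have "0 < digit t l" unfolding digit_def by (simp add: add_pos_nonneg)
  then show "0 < \<tau> t l" using N_pos by (simp add: \<tau>_def M_def)
  have "int (B (l mod k)) * \<lfloor>real (N l) * t\<rfloor> \<le> int Bmax * int (N l)"
    using fl B_mod_le by (intro mult_mono) auto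
  moreover have "1 * 1 \<le> int Bmax * int (N l)"
    using Bmax_ge N_pos[of l] by (intro mult_mono) auto
  ultimately have "digit t l \<le> 2 * int Bmax * int (N l)" unfolding digit_def by linarith
  then have "real_of_int (digit t l) \<le> 2 * real Bmax * real (N l)"
    using of_int_le_iff[where 'a = real, of "digit t l" "2 * int Bmax * int (N l)"] by simp
  then have "\<tau> t l \<le> 2 * real Bmax * real (N l) / real (M l)"
    unfolding \<tau>_def by (rule divide_right_mono) simp
  also have "\<dots> = 2 * real Bmax / real (N l)" using N_pos[of l] by (simp add: M_def power2_eq_square)
  finally show "\<tau> t l \<le> 2 * real Bmax / real (N l)" .
qed

lemma tau_tail:
  assumes t: "0 \<le> t" "t \<le> 1"
  shows "summable (\<lambda>u. \<tau> t (l + k * u))" "tail t l \<le> 4 * real Bmax / real (N l)" "0 < tail t l"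
proof -
  have le: "\<tau> t (l + k * u) \<le> 2 * real Bmax / real (N l) * (1 / 2) ^ u" for u
  proof -
    have "2 ^ u * N l \<le> N (l + u)" by (rule N_power)
    also have "\<dots> \<le> N (l + k * u)" using k_pos by (intro N_mono) (simp add: Suc_le_eq)
    finally have "2 ^ u * real (N l) \<le> real (N (l + k * u))"
      by (metis of_nat_le_iff of_nat_mult of_nat_numeral of_nat_power)
    then have "2 * real Bmax / real (N (l + k * u)) \<le> 2 * real Bmax / (2 ^ u * real (N l))"
      using N_pos by (intro divide_left_mono mult_pos_pos) auto
    also have "\<dots> = 2 * real Bmax / real (N l) * (1 / 2) ^ u" by (simp add: power_one_over field_simps)
    finally show ?thesis using tau_bounds(2)[OF t, of "l + k * u"] by linarith
  qed
  have geo: "(\<lambda>u. 2 * real Bmax / real (N l) * (1 / 2) ^ u) sums (2 * real Bmax / real (N l) * 2)"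
    using geometric_sums[of "1/2 :: real"] by (intro sums_mult) simp
  show sm: "summable (\<lambda>u. \<tau> t (l + k * u))"
  proof (rule summable_comparison_test'[of _ 0])
    show "summable (\<lambda>u. 2 * real Bmax / real (N l) * (1 / 2) ^ u)" using geo by (rule sums_summable)
    show "norm (\<tau> t (l + k * u)) \<le> 2 * real Bmax / real (N l) * (1 / 2) ^ u" for u
      using le[of u] tau_bounds(1)[OF t, of "l + k * u"] by simp
  qed
  have "tail t l \<le> (\<Sum>u. 2 * real Bmax / real (N l) * (1 / 2) ^ u)"
    unfolding tail_def using le sm geo by (intro suminf_le) (auto simp: sums_iff)
  also have "\<dots> = 4 * real Bmax / real (N l)" using geo by (simp add: sums_iff)
  finally show "tail t l \<le> 4 * real Bmax / real (N l)" .
  show "0 < tail t l" unfolding tail_def using sm tau_bounds(1)[OF t] by (rule suminf_pos)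
qed

lemma tail_measurable [measurable]: "(\<lambda>t. tail t l) \<in> borel_measurable borel"
  unfolding tail_def \<tau>_def digit_def by simp

text \<open>All terms but the last carry a positive power of the prime, and the last digit is 1
  modulo the prime.\<close>

lemma num_coprime: "coprime (num t m) (int (M m))"
proof -
  define b where "b = int (B (m mod k))"
  define v where "v = m div k"
  have split: "num t m = digit t m + (\<Sum>u<v. digit t (m mod k + k * u) * b ^ (2 * (e m - e (m mod k + k * u))))"
    by (simp add: num_def v_def b_def lessThan_Suc_atMost[symmetric] add.commute)
  have "b dvd digit t (m mod k + k * u) * b ^ (2 * (e m - e (m mod k + k * u)))" if "u < v" for u
  proof -
    have "m mod k + k * u < m mod k + k * v" using that k_pos by simp
    also have "\<dots> = m" by (simp add: v_def)
    finally have "e (m mod k + k * u) < e m" using e_strict by (simp add: strict_mono_less)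
    then show ?thesis by (intro dvd_mult dvd_power) auto
  qed
  then have "b dvd (\<Sum>u<v. digit t (m mod k + k * u) * b ^ (2 * (e m - e (m mod k + k * u))))"
    by (intro dvd_sum) auto
  moreover have "b dvd digit t m - 1" by (simp add: digit_def b_def)
  ultimately have "b dvd (digit t m - 1) + (\<Sum>u<v. digit t (m mod k + k * u) * b ^ (2 * (e m - e (m mod k + k * u))))"
    by (intro dvd_add)
  then have dvd: "b dvd num t m - 1" by (simp add: split algebra_simps)
  have "coprime (num t m) b"
  proof (rule coprimeI)
    fix c assume c: "c dvd num t m" "c dvd b"
    have "c dvd num t m - (num t m - 1)" using c(1) dvd_trans[OF c(2) dvd] by (rule dvd_diff)
    then show "is_unit c" by simp
  qed
  then have "coprime (num t m) (b ^ (e m * 2))" by simp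
  then show ?thesis by (simp add: M_def N_def b_def power_mult)
qed

lemma num_approx:
  assumes t: "0 \<le> t" "t \<le> 1"
  shows "real (M m) * tail t (m mod k) - of_int (num t m) = real (M m) * tail t (m + k)"
proof -
  \<comment> \<open>These are the terms of levels \<open>m mod k\<close> up to and including
    \<open>m\<close>; the next level of the class is \<open>m + k\<close>.\<close>
  define v where "v = Suc (m div k)"
  have "(m mod k + k * v) = m + k" by (simp add: v_def)
  then have shift: "m mod k + k * (u + v) = m + k + k * u" for u by (simp add: algebra_simps)
  have "tail t (m mod k) = (\<Sum>u. \<tau> t (m mod k + k * (u + v))) + (\<Sum>u<v. \<tau> t (m mod k + k * u))"
    unfolding tail_def using tau_tail(1)[OF t] by (rule suminf_split_initial_segment)
  also have "(\<Sum>u. \<tau> t (m mod k + k * (u + v))) = tail t (m + k)" unfolding shift tail_def ..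
  finally have 1: "tail t (m mod k) = tail t (m + k) + (\<Sum>u<v. \<tau> t (m mod k + k * u))" .
  have "real (M m) * \<tau> t (m mod k + k * u) = of_int (digit t (m mod k + k * u) * int (B (m mod k) ^ (2 * (e m - e (m mod k + k * u)))))"
    if "u < v" for u
  proof -
    define l where "l = m mod k + k * u"
    have lk: "l mod k = m mod k" by (simp add: l_def)
    have "k * u \<le> k * (m div k)" using that by (intro mult_le_mono2) (simp add: v_def)
    then have "l \<le> m" unfolding l_def using mult_div_mod_eq[of k m] by linarith
    then have "e l \<le> e m" using e_strict by (simp add: strict_mono_less_eq)
    then have "e m * 2 = e l * 2 + 2 * (e m - e l)" by simp
    then have "M m = M l * B (m mod k) ^ (2 * (e m - e l))"
      unfolding M_def N_def lk by (simp add: power_mult[symmetric] power_add[symmetric])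
    moreover have "M l > 0" using N_pos by (simp add: M_def)
    ultimately show ?thesis unfolding \<tau>_def l_def[symmetric] by simp
  qed
  then have "real (M m) * (\<Sum>u<v. \<tau> t (m mod k + k * u)) = of_int (num t m)"
    unfolding num_def v_def lessThan_Suc_atMost by (simp add: sum_distrib_left)
  then show ?thesis unfolding 1 by (simp add: distrib_left)
qed

text \<open>The remainder starts at a level of at least \<open>m + k\<close>, where
  \<open>N_Suc\<close> provides a power of the last denominator base of the window. One quantity,
  \<open>N (m + k - 1)\<close>, then controls everything.\<close>

lemma tail_err:
  assumes t: "0 \<le> t" "t \<le> 1" and m: "m \<le> l" "l < m + k"
  shows "\<bar>real (M l) * tail t (l + k)\<bar> \<le> 4 * real Bmax * real (N (m + k - 1)) ^ 2 / (real Z * real (N (m + k - 1))) ^ W"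
proof -
  have "0 < tail t (l + k)" using tau_tail(3)[OF t] .
  then have "\<bar>real (M l) * tail t (l + k)\<bar> = real (M l) * tail t (l + k)" by simp
  also have "\<dots> \<le> real (N (m + k - 1)) ^ 2 * (4 * real Bmax / (real Z * real (N (m + k - 1))) ^ W)"
  proof (intro mult_mono)
    have "N l \<le> N (m + k - 1)" using m by (intro N_mono) auto
    then show "real (M l) \<le> real (N (m + k - 1)) ^ 2" unfolding M_def of_nat_power by (intro power_mono) auto
    have "(Z * N (m + k - 1)) ^ W \<le> N (Suc (m + k - 1))" by (rule N_Suc)
    also have "\<dots> \<le> N (l + k)" using m k_pos by (intro N_mono) auto
    finally have "(real Z * real (N (m + k - 1))) ^ W \<le> real (N (l + k))"
      by (metis of_nat_le_iff of_nat_mult of_nat_power)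
    then have "4 * real Bmax / real (N (l + k)) \<le> 4 * real Bmax / (real Z * real (N (m + k - 1))) ^ W"
      using Z2 N_pos by (intro divide_left_mono mult_pos_pos zero_less_power) auto
    then show "tail t (l + k) \<le> 4 * real Bmax / (real Z * real (N (m + k - 1))) ^ W"
      using tau_tail(2)[OF t, of "l + k"] by linarith
  qed (use \<open>0 < tail t (l + k)\<close> in auto)
  finally show ?thesis by (simp add: mult.commute)
qed

text \<open>Every term is monotone in the parameter, so a single term bounds the difference of the
  sums from below. The first level that separates the parameters serves, and
  \<open>N_step_le\<close> keeps its denominator polynomial in \<open>1 / (t' - t)\<close>.\<close>

lemma tail_expanding:
  assumes t: "0 \<le> t" "t \<le> t'" "t' \<le> 1"
  shows "((t' - t) / 2) ^ (2 * (Bmax * (2 * E) ^ k)) \<le> tail t' 0 - tail t 0"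
proof (cases "t = t'")
  case True
  then show ?thesis using Bmax_ge E_pos by (auto simp: zero_power)
next
  case False
  define A where "A = Bmax * (2 * E) ^ k"
  define \<Delta> where "\<Delta> = t' - t"
  have \<Delta>: "0 < \<Delta>" "\<Delta> \<le> 1" using t False by (auto simp: \<Delta>_def)
  have t1: "t \<le> 1" "0 \<le> t'" using t by auto
  have mono: "\<tau> t l \<le> \<tau> t' l" for l
    unfolding \<tau>_def digit_def using t
    by (intro divide_right_mono of_int_le_iff[THEN iffD2] add_left_mono mult_left_mono floor_mono) auto
  have single: "\<tau> t' (k * u) - \<tau> t (k * u) \<le> tail t' 0 - tail t 0" for u
  proof -
    have s: "summable (\<lambda>u. \<tau> t (0 + k * u))" "summable (\<lambda>u. \<tau> t' (0 + k * u))"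
      using tau_tail(1) t t1 by blast+
    have "tail t' 0 - tail t 0 = (\<Sum>u. \<tau> t' (0 + k * u) - \<tau> t (0 + k * u))"
      unfolding tail_def using s by (simp add: suminf_diff)
    moreover have "(\<Sum>u\<in>{u}. \<tau> t' (0 + k * u) - \<tau> t (0 + k * u)) \<le> (\<Sum>u. \<tau> t' (0 + k * u) - \<tau> t (0 + k * u))"
      using s mono by (intro sum_le_suminf summable_diff) auto
    ultimately show ?thesis by simp
  qed
  have jump: "1 / real (M (k * u)) \<le> tail t' 0 - tail t 0" if "1 \<le> real (N (k * u)) * \<Delta>" for u
  proof -
    have "real (N (k * u)) * t + 1 \<le> real (N (k * u)) * t'" using that by (simp add: \<Delta>_def algebra_simps)
    then have "\<lfloor>real (N (k * u)) * t\<rfloor> + 1 \<le> \<lfloor>real (N (k * u)) * t'\<rfloor>"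
      by (metis floor_add_int floor_mono of_int_1)
    then have "1 * 1 \<le> int (B 0) * (\<lfloor>real (N (k * u)) * t'\<rfloor> - \<lfloor>real (N (k * u)) * t\<rfloor>)"
      using B_ge[of 0] by (intro mult_mono) auto
    then have "1 \<le> digit t' (k * u) - digit t (k * u)" by (simp add: digit_def right_diff_distrib)
    then have "1 / real (M (k * u)) \<le> of_int (digit t' (k * u) - digit t (k * u)) / real (M (k * u))"
      by (intro divide_right_mono) auto
    also have "\<dots> = \<tau> t' (k * u) - \<tau> t (k * u)" by (simp add: \<tau>_def diff_divide_distrib)
    finally show ?thesis using single[of u] by linarith
  qed
  have "\<exists>u. 1 \<le> real (N (k * u)) * \<Delta>"
  proof -
    obtain u :: nat where u: "1 / \<Delta> \<le> real u" using real_arch_simple by blast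
    have "u \<le> N u" using N_strict by (rule strict_mono_imp_increasing)
    also have "N u \<le> N (k * u)" using k_pos by (intro N_mono) auto
    finally have "1 / \<Delta> \<le> real (N (k * u))" using u by (meson of_nat_le_iff order_trans)
    then show ?thesis using \<Delta> by (auto simp: divide_le_eq intro!: exI[of _ u])
  qed
  \<comment> \<open>Minimality of \<open>u\<close> gives an upper bound for the preceding
    denominator in terms of \<open>\<Delta>\<close>.\<close>
  then obtain u where u: "1 \<le> real (N (k * u)) * \<Delta>" and min: "\<And>v. v < u \<Longrightarrow> real (N (k * v)) * \<Delta> < 1"
    using exists_least_iff[of "\<lambda>u. 1 \<le> real (N (k * u)) * \<Delta>"] by (meson not_le)
  have "(\<Delta> / 2) ^ (2 * A) \<le> 1 / real (M (k * u))"
  proof (cases u)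
    case 0
    then have "real (M (k * u)) = 1" by (simp add: M_def N_0)
    then show ?thesis using \<Delta> by (simp add: power_le_one)
  next
    case (Suc v)
    then have "real (N (k * v)) * \<Delta> < 1" using min by simp
    then have "real (N (k * v)) \<le> 1 / \<Delta>" using \<Delta> by (simp add: field_simps)
    then have "2 * real (N (k * v)) \<le> 2 / \<Delta>" by simp
    then have "(2 * real (N (k * v))) ^ A \<le> (2 / \<Delta>) ^ A" by (intro power_mono) auto
    moreover have "real (N (k * u)) \<le> (2 * real (N (k * v))) ^ A"
      using N_step_le[of "k * v"] unfolding Suc A_def
      by (metis mult_Suc_right add.commute of_nat_le_iff of_nat_mult of_nat_numeral of_nat_power)
    ultimately have "real (N (k * u)) \<le> (2 / \<Delta>) ^ A" by linarith
    then have "real (N (k * u)) ^ 2 \<le> ((2 / \<Delta>) ^ A) ^ 2" by (intro power_mono) auto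
    also have "\<dots> = (2 / \<Delta>) ^ (2 * A)" by (simp add: power_mult[symmetric] mult.commute)
    finally have "1 / (2 / \<Delta>) ^ (2 * A) \<le> 1 / real (M (k * u))"
      unfolding M_def of_nat_power using N_pos \<Delta> by (intro divide_left_mono) auto
    then show ?thesis by (simp add: power_divide)
  qed
  then show ?thesis using jump[OF u] unfolding A_def[symmetric] \<Delta>_def[symmetric] by linarith
qed

end

section \<open>Errors compared with powers of the denominators\<close>

context prime_digits
begin

text \<open>One factor \<open>Z\<close> already beats the constant \<open>C / D\<close>, and
  \<open>P ^ W\<close> takes care of \<open>P ^ a\<close>.\<close>

lemma power_div_less:
  fixes P C D :: real
  assumes "C < D * real Z" "a \<le> W" "1 \<le> P" "0 < D"
  shows "C * P ^ a / (real Z * P) ^ W < D"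
proof -
  have "real Z * P ^ a \<le> real Z ^ W * P ^ W"
    using assms W1 Z2 by (intro mult_mono power_increasing self_le_power) auto
  then have le: "real Z * P ^ a \<le> (real Z * P) ^ W" by (simp add: power_mult_distrib)
  have "C * P ^ a < D * real Z * P ^ a" using assms by (intro mult_strict_right_mono) auto
  also have "\<dots> = D * (real Z * P ^ a)" by simp
  also have "\<dots> \<le> D * (real Z * P) ^ W" using le assms by (intro mult_left_mono) auto
  finally show ?thesis using assms Z2 by (simp add: divide_less_eq)
qed

lemma M_le_top:
  assumes "j < m + k"
  shows "real (M j) \<le> real (N (m + k - 1)) ^ 2"
proof -
  have "N j \<le> N (m + k - 1)" using assms by (intro N_mono) auto
  then show ?thesis unfolding M_def of_nat_power by (intro power_mono) auto
qed

text \<open>The exponent \<open>2 * k + 4\<close> collects 2 from the error, 2 from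
  \<open>M (Suc m)\<close> and 2 from each of the \<open>k\<close> denominators. Since
  \<open>2 \<le> k\<close>, level \<open>Suc m\<close> still lies in the window.\<close>

lemma tail_err_small:
  assumes t: "0 \<le> t" "t \<le> 1" and m: "m \<le> l" "l < m + k"
    and k2: "2 \<le> k" and Z: "4 * Bmax * (k + 1) < Z" and W: "2 * k + 4 \<le> W"
  shows "\<bar>real (M l) * tail t (l + k)\<bar> * ((1 + real k * real (M (Suc m))) * (\<Prod>j\<in>{m..<m+k}. real (M j))) < 1"
proof -
  define P where "P = real (N (m + k - 1))"
  have P: "1 \<le> P" using N_pos[of "m + k - 1"] by (simp add: P_def)
  have "1 + real k * real (M (Suc m)) \<le> P ^ 2 + real k * P ^ 2"
    using M_le_top[of "Suc m" m] k2 P by (intro add_mono mult_left_mono one_le_power) (auto simp: P_def)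
  moreover have "(\<Prod>j\<in>{m..<m+k}. real (M j)) \<le> (P ^ 2) ^ k"
  proof -
    have "(\<Prod>j\<in>{m..<m+k}. real (M j)) \<le> (\<Prod>j\<in>{m..<m+k}. P ^ 2)"
      using M_le_top by (intro prod_mono) (auto simp: P_def)
    then show ?thesis by simp
  qed
  ultimately have le: "(1 + real k * real (M (Suc m))) * (\<Prod>j\<in>{m..<m+k}. real (M j)) \<le> (P ^ 2 + real k * P ^ 2) * (P ^ 2) ^ k"
    using P by (intro mult_mono) (auto intro: prod_nonneg)
  have "\<bar>real (M l) * tail t (l + k)\<bar> * ((1 + real k * real (M (Suc m))) * (\<Prod>j\<in>{m..<m+k}. real (M j)))
      \<le> (4 * real Bmax * P ^ 2 / (real Z * P) ^ W) * ((P ^ 2 + real k * P ^ 2) * (P ^ 2) ^ k)"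
  proof (rule mult_mono[OF tail_err[OF t m, folded P_def] le])
    show "0 \<le> 4 * real Bmax * P ^ 2 / (real Z * P) ^ W" using P by simp
    show "0 \<le> (1 + real k * real (M (Suc m))) * (\<Prod>j\<in>{m..<m+k}. real (M j))"
      by (intro mult_nonneg_nonneg prod_nonneg) auto
  qed
  also have "\<dots> = real (4 * Bmax * (k + 1)) * P ^ (2 * k + 4) / (real Z * P) ^ W"
  proof -
    have "P ^ (2 * k + 4) = P ^ 2 * (P ^ 2 * (P ^ 2) ^ k)"
      unfolding power_mult[symmetric] power_add[symmetric] by (rule arg_cong[where f = "power P"]) simp
    then show ?thesis by (simp add: algebra_simps add_divide_distrib)
  qed
  also have "\<dots> < 1"
    using Z by (intro power_div_less W P) (simp_all only: mult_1 of_nat_less_iff zero_less_one)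
  finally show ?thesis .
qed

text \<open>Here \<open>R\<close> stands for the norm of a competitor. It is below
  \<open>M (Suc m)\<close>, hence at most the square of \<open>N (m + k - 1)\<close>, so
  \<open>W\<close> outweighs its power.\<close>

lemma tail_err_generic:
  assumes t: "0 \<le> t" "t \<le> 1" and k2: "2 \<le> k"
    and R: "0 < R" "R < real (M (Suc m))" and \<kappa>: "0 < \<kappa>" "4 * real Bmax < \<kappa> * real Z"
    and W: "2 * p + 2 \<le> W"
  shows "\<bar>real (M m) * tail t (m + k)\<bar> < \<kappa> / R ^ p"
proof -
  define P where "P = real (N (m + k - 1))"
  have P: "1 \<le> P" using N_pos[of "m + k - 1"] by (simp add: P_def)
  have "Suc m < m + k" using k2 by simp
  from M_le_top[OF this] have "R \<le> P ^ 2" using R(2) unfolding P_def by linarith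
  then have Rp: "R ^ p \<le> (P ^ 2) ^ p" using R by (intro power_mono) auto
  have "\<bar>real (M m) * tail t (m + k)\<bar> \<le> 4 * real Bmax * P ^ 2 / (real Z * P) ^ W"
    using tail_err[OF t, of m m] k_pos by (simp add: P_def)
  then have "\<bar>real (M m) * tail t (m + k)\<bar> * R ^ p \<le> (4 * real Bmax * P ^ 2 / (real Z * P) ^ W) * (P ^ 2) ^ p"
    using Rp R by (intro mult_mono) auto
  also have "\<dots> = 4 * real Bmax * P ^ (2 * p + 2) / (real Z * P) ^ W"
    by (simp add: power_mult[symmetric] power_add[symmetric] add.commute)
  also have "\<dots> < \<kappa>" using \<kappa> W P by (intro power_div_less) auto
  finally show ?thesis using R by (simp add: less_divide_eq)
qed

end

section \<open>The set of vectors\<close>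

locale digit_vectors = prime_digits B Bmax k E Z W
  for B :: "nat \<Rightarrow> nat" and Bmax k E Z W +
  fixes idx :: "nat \<Rightarrow> 'n::finite" and n :: nat
  assumes idx: "bij_betw idx {1..n} UNIV" and k2: "2 \<le> k" and kn: "k \<le> n"
begin

text \<open>
  The coordinates \<open>idx 2, \<dots>, idx k\<close> of the argument of \<^term>\<open>X\<close> are dummies, so that \<^term>\<open>X\<close> can be
  studied with Lebesgue measure on the same space.
\<close>

definition X :: "real ^ 'n \<Rightarrow> real ^ 'n" where
  "X z = (\<chi> i. if i \<in> idx ` {1..k} then tail (z $ idx 1) (inv_into {1..n} idx i - 1) else z $ i)"

lemma idx_inj: "inj_on idx {1..n}" using idx by (simp add: bij_betw_def)

lemma idx_eq: "i \<in> {1..n} \<Longrightarrow> j \<in> {1..n} \<Longrightarrow> idx i = idx j \<longleftrightarrow> i = j"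
  using idx_inj by (rule inj_on_eq_iff)

lemma idx_mem:
  assumes "j \<in> {1..n}"
  shows "idx j \<in> idx ` {1..k} \<longleftrightarrow> j \<le> k"
proof -
  have "{1..k} \<subseteq> {1..n}" using kn by simp
  then have "idx j \<in> idx ` {1..k} \<longleftrightarrow> j \<in> {1..k}"
    using assms idx_inj by (intro inj_on_image_mem_iff)
  then show ?thesis using assms by simp
qed

lemma card_n: "CARD('n) = n" using bij_betw_same_card[OF idx] by simp

lemma X_low:
  assumes "c < k"
  shows "X z $ idx (Suc c) = tail (z $ idx 1) c"
proof -
  have "idx (Suc c) \<in> idx ` {1..k}" using assms by simp
  moreover have "inv_into {1..n} idx (idx (Suc c)) = Suc c"
    using assms kn idx_inj by (intro inv_into_f_f) auto
  ultimately show ?thesis by (simp add: X_def)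
qed

lemma X_high: "i \<notin> idx ` {1..k} \<Longrightarrow> X z $ i = z $ i"
  by (simp add: X_def)

lemma X_measurable: "(\<lambda>z. X z $ i) \<in> borel_measurable borel"
proof (cases "i \<in> idx ` {1..k}")
  case True
  then show ?thesis by (simp add: X_def)
next
  case False
  then show ?thesis by (simp add: X_def)
qed

text \<open>The bound involves neither \<open>Z\<close> nor \<open>E\<close>, which allows
  \<open>\<kappa>\<close> to be chosen before them.\<close>

lemma X_bound:
  assumes "z \<in> cube"
  shows "\<bar>X z $ i\<bar> \<le> 4 * real Bmax"
proof (cases "i \<in> idx ` {1..k}")
  case True
  define l where "l = inv_into {1..n} idx i - 1"
  have t: "0 \<le> z $ idx 1" "z $ idx 1 \<le> 1" using assms by (auto simp: mem_cube)
  have "4 * real Bmax / real (N l) \<le> 4 * real Bmax / 1"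
    using N_pos[of l] by (intro divide_left_mono) auto
  then show ?thesis using True tau_tail(2,3)[OF t, of l] by (simp add: X_def l_def)
next
  case False
  have "0 \<le> z $ i" "z $ i \<le> 1" using assms by (auto simp: mem_cube)
  moreover have "2 \<le> real Bmax" using Bmax_ge by linarith
  ultimately show ?thesis using False by (simp add: X_high)
qed

lemma X_shift:
  assumes "j \<in> idx ` {k<..n}" "i \<noteq> j"
  shows "X (z + s *\<^sub>R axis j 1) $ i = X z $ i"
proof -
  have "j \<noteq> idx 1" using assms(1) k2 kn by (auto simp: idx_eq)
  then show ?thesis using assms(2) by (simp add: X_def axis_def)
qed

text \<open>By \<open>num_approx\<close> the errors are scaled remainders of the series, which are
  positive and subject to the estimates above; \<open>gen\<close> bounds the forms that involve a
  free coordinate.\<close>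

lemma liouville_vector_X:
  assumes z: "z \<in> cube"
    and Z: "4 * Bmax * (k + 1) < Z" and W: "2 * n + 2 * k + 8 \<le> W"
    and \<kappa>: "0 < \<kappa>" "4 * real Bmax < \<kappa> * real Z"
    and gen: "\<And>b j. b \<in> int_points \<Longrightarrow> j \<in> idx ` {k<..n} \<Longrightarrow> fst b $ j \<noteq> 0 \<Longrightarrow>
      \<kappa> / infnorm (fst b) ^ (n + 3) \<le> \<bar>b \<bullet> append_one (X z)\<bar>"
  shows "liouville_vector idx n k (X z) M (num (z $ idx 1))"
proof -
  interpret I: interlaced idx n k "X z" M "num (z $ idx 1)"
    using idx k2 kn by unfold_locales
  have t: "0 \<le> z $ idx 1" "z $ idx 1 \<le> 1" using z by (auto simp: mem_cube)
  have err: "I.err m = real (M m) * tail (z $ idx 1) (m + k)" for m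
  proof -
    have "m mod k < k" using k_pos by simp
    then show ?thesis unfolding I.err_def I.coord_def by (simp only: X_low num_approx[OF t])
  qed
  show ?thesis
  proof unfold_locales
    show "M 0 = 1" by (simp add: M_def N_0)
    show "strict_mono M" by (rule M_strict)
    show "coprime (num (z $ idx 1) m) (int (M m))" for m by (rule num_coprime)
    show "coprime (M l) (M m)" if "l mod k \<noteq> m mod k" for l m using that by (rule M_coprime)
    show "I.err m \<noteq> 0" for m
      unfolding err using tau_tail(3)[OF t, of "m + k"] N_pos[of m] by (simp add: M_def)
    show "\<bar>I.err l\<bar> * ((1 + real k * real (M (Suc m))) * (\<Prod>j\<in>{m..<m+k}. real (M j))) < 1"
      if "m \<le> l" "l < m + k" for m l
      unfolding err using t that k2 Z W by (intro tail_err_small) auto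
    show "\<bar>I.err m\<bar> < \<bar>b \<bullet> append_one (X z)\<bar>"
      if b: "b \<in> int_points" "infnorm (fst b) < real (M (Suc m))" and j: "j \<in> {k<..n}" "fst b $ idx j \<noteq> 0" for m b j
    proof -
      have "fst b \<noteq> 0" using j by auto
      then have "0 < infnorm (fst b)" by (simp add: infnorm_pos_lt)
      then have "\<bar>I.err m\<bar> < \<kappa> / infnorm (fst b) ^ (n + 3)"
        unfolding err using t k2 b(2) \<kappa> W by (intro tail_err_generic) auto
      also have "\<dots> \<le> \<bar>b \<bullet> append_one (X z)\<bar>" using b(1) j by (intro gen) auto
      finally show ?thesis .
    qed
  qed
qed

text \<open>The reciprocal of the exponent in \<open>tail_expanding\<close>, that is, the Hoelder
  exponent of the parameter as a function of the first coordinate.\<close>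

definition dim_gain :: real where "dim_gain = 1 / real (2 * (Bmax * (2 * E) ^ k))"

lemma dim_gain_pos: "0 < dim_gain"
  using Bmax_ge E_pos by (simp add: dim_gain_def)

lemma X_inverse_Hoelder:
  assumes z: "z \<in> cube" "z' \<in> cube" and d: "\<bar>X z $ idx 1 - X z' $ idx 1\<bar> \<le> d"
  shows "\<bar>z $ idx 1 - z' $ idx 1\<bar> \<le> 2 * d powr dim_gain"
proof -
  define A where "A = 2 * (Bmax * (2 * E) ^ k)"
  have A: "A > 0" using Bmax_ge E_pos by (simp add: A_def)
  have d0: "d \<ge> 0" using d by linarith
  define q where "q = \<bar>z $ idx 1 - z' $ idx 1\<bar> / 2"
  have X1: "X y $ idx 1 = tail (y $ idx 1) 0" for y using X_low[of 0 y] k_pos by simp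
  have t: "0 \<le> z $ idx 1" "z $ idx 1 \<le> 1" "0 \<le> z' $ idx 1" "z' $ idx 1 \<le> 1"
    using z by (auto simp: mem_cube)
  have "q ^ A \<le> \<bar>X z $ idx 1 - X z' $ idx 1\<bar>"
  proof (cases "z $ idx 1 \<le> z' $ idx 1")
    case True
    then have "q = (z' $ idx 1 - z $ idx 1) / 2" by (simp add: q_def)
    then have "q ^ A \<le> tail (z' $ idx 1) 0 - tail (z $ idx 1) 0"
      unfolding A_def by (simp only: tail_expanding[OF t(1) True t(4)])
    then show ?thesis unfolding X1 by linarith
  next
    case False
    then have le: "z' $ idx 1 \<le> z $ idx 1" by simp
    then have "q = (z $ idx 1 - z' $ idx 1) / 2" by (simp add: q_def)
    then have "q ^ A \<le> tail (z $ idx 1) 0 - tail (z' $ idx 1) 0"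
      unfolding A_def by (simp only: tail_expanding[OF t(3) le t(2)])
    then show ?thesis unfolding X1 by linarith
  qed
  also note d
  also have "d = (d powr dim_gain) ^ A"
  proof -
    have "dim_gain = 1 / real A" by (simp only: dim_gain_def A_def)
    then show ?thesis using A d0 by (cases "d = 0") (simp_all add: powr_power)
  qed
  finally have "q \<le> d powr dim_gain" using A by (subst (asm) power_mono_iff) (auto simp: q_def)
  then show ?thesis by (simp add: q_def)
qed

text \<open>The preimage of a set of diameter \<open>d\<close> lies in a box whose sides are
  proportional to \<open>d powr dim_gain\<close> once, to \<open>d\<close> in the
  \<open>n - k\<close> free directions, and constant in the dummy directions.\<close>

lemma hausdorff_dim_X:
  assumes T: "T \<in> sets lborel" "T \<subseteq> cube" "emeasure lborel T > 0"
  shows "ereal (real n - real k + dim_gain) \<le> hausdorff_dim (X ` T)"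
proof (rule hausdorff_dim_image_ge)
  show "bounded T" using T(2) unfolding cube_def by (rule bounded_subset[rotated]) simp
  show "0 < (2 :: real) ^ (n + 1)" by simp
  fix U :: "(real ^ 'n) set"
  assume U: "bounded U" "diameter U \<le> 1"
  define d where "d = diameter U"
  have d: "0 \<le> d" "d \<le> 1" using U diameter_ge_0 by (auto simp: d_def)
  show "\<exists>V\<in>sets lborel. T \<inter> X -` U \<subseteq> V \<and> emeasure lborel V \<le> ennreal (2 ^ (n + 1) * diameter U powr (real n - real k + dim_gain))"
  proof (cases "T \<inter> X -` U = {}")
    case True
    then show ?thesis by (intro bexI[of _ "{}"]) auto
  next
    case False
    then obtain z0 where z0: "z0 \<in> T" "X z0 \<in> U" by auto
    \<comment> \<open>Half side lengths: the Hoelder bound along \<open>idx 1\<close>, the width of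
      the cube along the dummies, and \<open>d\<close> along the free coordinates.\<close>
    define h :: "real ^ 'n" where
      "h = (\<chi> i. if i = idx 1 then 2 * d powr dim_gain else if i \<in> idx ` {1..k} then 1 else d)"
    have h: "0 \<le> h $ i" for i using d by (simp add: h_def)
    define V where "V = cbox (z0 - h) (z0 + h)"
    have "T \<inter> X -` U \<subseteq> V"
    proof
      fix z assume z: "z \<in> T \<inter> X -` U"
      have close: "\<bar>X z $ i - X z0 $ i\<bar> \<le> d" for i
      proof -
        have "\<bar>(X z - X z0) $ i\<bar> \<le> dist (X z) (X z0)"
          unfolding dist_norm by (rule component_le_norm_cart)
        also have "\<dots> \<le> d" unfolding d_def using U(1) z z0 by (intro diameter_bounded_bound) auto
        finally show ?thesis by simp
      qed
      have cube: "z \<in> cube" "z0 \<in> cube" using z z0 T(2) by auto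
      have "\<bar>z $ i - z0 $ i\<bar> \<le> h $ i" for i
      proof -
        consider "i = idx 1" | "i \<noteq> idx 1" "i \<in> idx ` {1..k}" | "i \<noteq> idx 1" "i \<notin> idx ` {1..k}" by blast
        then show ?thesis
        proof cases
          case 1
          then show ?thesis using X_inverse_Hoelder[OF cube close] by (simp add: h_def)
        next
          case 2
          have "0 \<le> z $ i" "z $ i \<le> 1" "0 \<le> z0 $ i" "z0 $ i \<le> 1" using cube by (auto simp: mem_cube)
          then show ?thesis using 2 by (simp add: h_def)
        next
          case 3
          then show ?thesis using close[of i] by (simp add: h_def X_high)
        qed
      qed
      then show "z \<in> V" unfolding V_def mem_box_cart by (simp add: abs_le_iff) (smt (verit))
    qed
    moreover have "emeasure lborel V = ennreal (2 ^ (n + 1) * d powr (real n - real k + dim_gain))"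
    proof -
      have "emeasure lborel V = ennreal (measure lborel V)"
        unfolding V_def by (rule emeasure_eq_ennreal_measure) (simp add: emeasure_lborel_cbox_eq)
      also have "measure lborel V = (\<Prod>i\<in>UNIV. 2 * h $ i)"
        unfolding V_def using h
        by (subst content_cbox_cart) (auto simp: interval_ne_empty_cart intro!: prod.cong order_trans[of "z0 $ _ - h $ _" "z0 $ _"])
      also have "\<dots> = (\<Prod>j\<in>{1..n}. 2 * h $ idx j)"
        using idx by (rule prod.reindex_bij_betw[symmetric])
      also have "{1..n} = {1} \<union> {2..k} \<union> {k<..n}" using k2 kn by auto
      also have "(\<Prod>j\<in>{1} \<union> {2..k} \<union> {k<..n}. 2 * h $ idx j)
          = (\<Prod>j\<in>{1}. 2 * h $ idx j) * (\<Prod>j\<in>{2..k}. 2 * h $ idx j) * (\<Prod>j\<in>{k<..n}. 2 * h $ idx j)"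
        using k2 by (subst prod.union_disjoint, (auto)[3])+ simp
      also have "(\<Prod>j\<in>{1}. 2 * h $ idx j) = 4 * d powr dim_gain" by (simp add: h_def)
      also have "(\<Prod>j\<in>{2..k}. 2 * h $ idx j) = (\<Prod>j\<in>{2..k}. 2)"
        using kn k2 by (intro prod.cong) (auto simp: h_def idx_eq)
      also have "\<dots> = 2 ^ (k - 1)" by simp
      also have "(\<Prod>j\<in>{k<..n}. 2 * h $ idx j) = (\<Prod>j\<in>{k<..n}. 2 * d)"
        using kn k2 by (intro prod.cong) (auto simp: h_def idx_eq idx_mem)
      also have "\<dots> = (2 * d) ^ (n - k)" by simp
      also have "4 * d powr dim_gain * 2 ^ (k - 1) * (2 * d) ^ (n - k) = 2 ^ (n + 1) * (d powr dim_gain * d ^ (n - k))"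
      proof -
        have "n + 1 = 2 + (k - 1) + (n - k)" using k2 kn by simp
        then have "(2::real) ^ (n + 1) = 4 * 2 ^ (k - 1) * 2 ^ (n - k)" by (simp only: power_add) simp
        then show ?thesis by (simp add: power_mult_distrib)
      qed
      also have "d powr dim_gain * d ^ (n - k) = d powr (real n - real k + dim_gain)"
      proof (cases "d = 0")
        case False
        then show ?thesis using d kn by (simp add: powr_add powr_realpow[symmetric] of_nat_diff)
      qed simp
      finally show ?thesis .
    qed
    ultimately show ?thesis unfolding d_def[symmetric] by (intro bexI[of _ V]) (auto simp: V_def)
  qed
qed (use T in auto)

end

text \<open>The order of the choices matters: the primes fix \<open>Bmax\<close>, this fixes
  \<open>\<kappa>\<close>, then come \<open>Z\<close> and \<open>W\<close>, and \<open>E\<close>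
  last.\<close>

lemma digit_vectors_exist:
  fixes idx :: "nat \<Rightarrow> 'n::finite"
  assumes idx: "bij_betw idx {1..n} UNIV" and k2: "2 \<le> k" and kn: "k \<le> n"
  obtains S :: "(real ^ 'n) set" where "hausdorff_dim S > ereal (real n - real k)"
    "\<And>x. x \<in> S \<Longrightarrow> \<exists>M r. liouville_vector idx n k x M r"
proof -
  define B where "B = enumerate {p :: nat. prime p}"
  have B: "prime (B c)" for c
    using enumerate_in_set[OF primes_infinite] by (simp add: B_def)
  have B_inj: "inj B" unfolding B_def using primes_infinite
    by (rule inj_enumerate)
  define Bmax where "Bmax = (\<Sum>c<k. B c)"
  have Bmax: "B c \<le> Bmax" if "c < k" for c
    unfolding Bmax_def using that by (intro member_le_sum) auto
  have "2 \<le> B 0" using B prime_ge_2_nat by blast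
  then have Bmax1: "1 \<le> Bmax" using Bmax[of 0] k2 by linarith
  then have "1 \<le> 4 * real Bmax" by linarith
  then show thesis
  proof (rule generic_parameters[where 'n = 'n])
    fix \<kappa> :: real
    assume \<kappa>: "0 < \<kappa>"
      and gen: "\<And>X :: real ^ 'n \<Rightarrow> real ^ 'n. \<And>J.
        (\<And>i. (\<lambda>z. X z $ i) \<in> borel_measurable borel) \<Longrightarrow>
        (\<And>z i. z \<in> cube \<Longrightarrow> \<bar>X z $ i\<bar> \<le> 4 * real Bmax) \<Longrightarrow>
        (\<And>z j. j \<in> J \<Longrightarrow> X z $ j = z $ j) \<Longrightarrow>
        (\<And>z s i j. j \<in> J \<Longrightarrow> i \<noteq> j \<Longrightarrow> X (z + s *\<^sub>R axis j 1) $ i = X z $ i) \<Longrightarrow>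
        \<exists>T. T \<in> sets lborel \<and> T \<subseteq> cube \<and> emeasure lborel T > 0 \<and>
          (\<forall>z\<in>T. \<forall>b\<in>int_points. (\<exists>j\<in>J. fst b $ j \<noteq> 0) \<longrightarrow>
             \<kappa> / infnorm (fst b) ^ (CARD('n) + 3) \<le> \<bar>b \<bullet> append_one (X z)\<bar>)"
    obtain Z0 :: nat where Z0: "4 * real Bmax / \<kappa> < real Z0" using reals_Archimedean2 by blast
    \<comment> \<open>The summands serve \<open>tail_err_small\<close>, the comparison with
      \<open>\<kappa>\<close>, and \<open>2 \<le> Z\<close>.\<close>
    define Z where "Z = 4 * Bmax * (k + 1) + Z0 + 2"
    \<comment> \<open>This covers both \<open>2 * k + 4\<close> for \<open>tail_err_small\<close>
      and \<open>2 * (n + 3) + 2\<close> for \<open>tail_err_generic\<close>.\<close>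
    define W where "W = 2 * n + 2 * k + 8"
    have Z: "4 * real Bmax < \<kappa> * real Z"
    proof -
      have "4 * real Bmax < \<kappa> * real Z0" using Z0 \<kappa> by (simp add: divide_less_eq mult.commute)
      also have "\<dots> \<le> \<kappa> * real Z" using \<kappa> by (intro mult_left_mono) (auto simp: Z_def)
      finally show ?thesis .
    qed
    define E where "E = (Z * Bmax) ^ W"
    interpret digit_vectors B Bmax k E Z W idx n
    proof unfold_locales
      show "(Z * Bmax) ^ W \<le> 2 ^ E" unfolding E_def by (rule less_imp_le[OF less_exp])
      show "1 \<le> W" by (simp add: W_def)
      show "2 \<le> Z" by (simp add: Z_def)
      show "0 < k" using k2 by simp
    qed (use B B_inj Bmax idx k2 kn in auto)
    have high: "X z $ j = z $ j" if "j \<in> idx ` {k<..n}" for z j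
    proof -
      obtain i where i: "i \<in> {k<..n}" "j = idx i" using \<open>j \<in> idx ` {k<..n}\<close> by blast
      then have "idx i \<notin> idx ` {1..k}" by (subst idx_mem) auto
      then show ?thesis using i(2) X_high by blast
    qed
    have "\<exists>T. T \<in> sets lborel \<and> T \<subseteq> cube \<and> emeasure lborel T > 0 \<and>
        (\<forall>z\<in>T. \<forall>b\<in>int_points. (\<exists>j\<in>idx ` {k<..n}. fst b $ j \<noteq> 0) \<longrightarrow>
           \<kappa> / infnorm (fst b) ^ (CARD('n) + 3) \<le> \<bar>b \<bullet> append_one (X z)\<bar>)"
      by (rule gen[OF X_measurable X_bound high X_shift])
    then obtain T where T: "T \<in> sets lborel" "T \<subseteq> cube" "emeasure lborel T > 0"
      and Tgen: "\<And>z b j. z \<in> T \<Longrightarrow> b \<in> int_points \<Longrightarrow> j \<in> idx ` {k<..n} \<Longrightarrow> fst b $ j \<noteq> 0 \<Longrightarrow>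
        \<kappa> / infnorm (fst b) ^ (CARD('n) + 3) \<le> \<bar>b \<bullet> append_one (X z)\<bar>" by blast
    show thesis
    proof (rule that)
      have "ereal (real n - real k) < ereal (real n - real k + dim_gain)" using dim_gain_pos by simp
      also have "\<dots> \<le> hausdorff_dim (X ` T)" using T by (rule hausdorff_dim_X)
      finally show "ereal (real n - real k) < hausdorff_dim (X ` T)" .
      fix x assume "x \<in> X ` T"
      then obtain z where z: "z \<in> T" "x = X z" by blast
      have "liouville_vector idx n k (X z) M (num (z $ idx 1))"
      proof (rule liouville_vector_X[OF _ _ _ \<kappa> Z])
        show "z \<in> cube" using z T by auto
        show "\<kappa> / infnorm (fst b) ^ (n + 3) \<le> \<bar>b \<bullet> append_one (X z)\<bar>"
          if "b \<in> int_points" "j \<in> idx ` {k<..n}" "fst b $ j \<noteq> 0" for b j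
          using Tgen[OF z(1) that] unfolding card_n .
      qed (auto simp: Z_def W_def)
      then show "\<exists>M r. liouville_vector idx n k x M r" using z by blast
    qed
  qed
qed

text \<open>The sequence is determined only up to signs, so the claims are made for every choice of
  signs, and its existence is asserted as well.\<close>

theorem theorem5:
  fixes n k :: nat and idx :: "nat \<Rightarrow> 'n::finite"
  assumes "CARD('n) = n" and "bij_betw idx {1..n} (UNIV :: 'n set)"
    and "n \<ge> 3" and "2 \<le> k" and "k \<le> n"
  shows "\<exists>S :: (real ^ 'n) set.
    hausdorff_dim S > ereal (real n - real k) \<and>
    (\<forall>x\<in>S.
       totally_irrational x \<and>
       (\<exists>q. best_approximation_sequence x q) \<and>
       (\<forall>q. best_approximation_sequence x q \<longrightarrow>
          (\<exists>j0. \<forall>j\<ge>j0. q j \<in> (\<Union>i\<in>{1..k}. int_module.span {unit_vec (idx i), last_unit_vec})) \<and>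
          \<not> (\<exists>j1 \<L>. finite \<L> \<and> card \<L> < k \<and> (\<forall>L\<in>\<L>. sublattice 2 L) \<and>
                (\<forall>j\<ge>j1. q j \<in> \<Union>\<L>)) \<and>
          \<not> (\<exists>j1 d L. d \<le> k \<and> sublattice d L \<and> (\<forall>j\<ge>j1. q j \<in> L)))) \<and>
    (\<forall>i\<in>{1..k}. sublattice 2 (int_module.span {unit_vec (idx i), last_unit_vec})) \<and>
    int_module.span (\<Union>i\<in>{1..k}. int_module.span {unit_vec (idx i), last_unit_vec}) =
      int_module.span (insert last_unit_vec ((\<lambda>i. unit_vec (idx i)) ` {1..k})) \<and>
    sublattice (k + 1) (int_module.span (insert last_unit_vec ((\<lambda>i. unit_vec (idx i)) ` {1..k})))"
proof -
  obtain S :: "(real ^ 'n) set" where S: "hausdorff_dim S > ereal (real n - real k)"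
    "\<And>x. x \<in> S \<Longrightarrow> \<exists>M r. liouville_vector idx n k x M r"
    using digit_vectors_exist[OF assms(2,4,5)] by metis
  have props: "totally_irrational x \<and> (\<exists>q. best_approximation_sequence x q) \<and>
      (\<forall>q. best_approximation_sequence x q \<longrightarrow>
          (\<exists>j0. \<forall>j\<ge>j0. q j \<in> (\<Union>i\<in>{1..k}. int_module.span {unit_vec (idx i), last_unit_vec})) \<and>
          \<not> (\<exists>j1 \<L>. finite \<L> \<and> card \<L> < k \<and> (\<forall>L\<in>\<L>. sublattice 2 L) \<and>
                (\<forall>j\<ge>j1. q j \<in> \<Union>\<L>)) \<and>
          \<not> (\<exists>j1 d L. d \<le> k \<and> sublattice d L \<and> (\<forall>j\<ge>j1. q j \<in> L)))" if x: "x \<in> S" for x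
  proof -
    obtain M r where "liouville_vector idx n k x M r" using S(2)[OF x] by blast
    then interpret liouville_vector idx n k x M r .
    show ?thesis
    proof (intro conjI allI impI notI)
      show "totally_irrational x" by (rule totally_irrational)
      show "\<exists>q. best_approximation_sequence x q" using Q_sequence by blast
    next
      fix q assume "best_approximation_sequence x q"
      then show "\<exists>j0. \<forall>j\<ge>j0. q j \<in> (\<Union>i\<in>{1..k}. int_module.span {unit_vec (idx i), last_unit_vec})"
        \<comment> \<open>The whole sequence lies in the planes, so any \<open>j0\<close>
          works.\<close>
        using sequence_in_planes by blast
    next
      fix q assume "best_approximation_sequence x q" and
        "\<exists>j1 \<L>. finite \<L> \<and> card \<L> < k \<and> (\<forall>L\<in>\<L>. sublattice 2 L) \<and> (\<forall>j\<ge>j1. q j \<in> \<Union>\<L>)"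
      then show False using not_in_few_planes by (metis not_le)
    next
      fix q assume "best_approximation_sequence x q" and
        "\<exists>j1 d L. d \<le> k \<and> sublattice d L \<and> (\<forall>j\<ge>j1. q j \<in> L)"
      then show False using not_in_small_sublattice by (metis not_le)
    qed
  qed
  have planes: "sublattice 2 (int_module.span {unit_vec (idx i), last_unit_vec})" for i
    using sublattice_unit_vecs[of "{idx i}"] by (simp add: insert_commute numeral_2_eq_2)
  have inj: "inj_on idx {1..k}" using assms(2,5) by (auto simp: bij_betw_def intro: inj_on_subset)
  have "sublattice (k + 1) (int_module.span (insert last_unit_vec ((\<lambda>i. unit_vec (idx i)) ` {1..k})))"
    using sublattice_unit_vecs[of "idx ` {1..k}"] unfolding card_image[OF inj] image_image by simp
  moreover have "int_module.span (\<Union>i\<in>{1..k}. int_module.span {unit_vec (idx i), last_unit_vec}) =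
      int_module.span (insert last_unit_vec ((\<lambda>i. unit_vec (idx i)) ` {1..k}))"
    using assms(4) by (intro int_span_Union_insert) simp
  ultimately show ?thesis
    by (intro exI[of _ S] conjI ballI S(1) props planes)
qed

end
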